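(* Let $\mathscr{T}$ be a triangulated category with set indexed coproducts, with suspension functor $\Sigma$, and let $\mathscr{S}$ be a set of compact objects of $\mathscr{T}$. Then the pair $(\mathscr{A},\mathscr{B})$ of full subcategories of $\mathscr{T}$ given by $$\mathscr{B}=\{X\in\mathscr{T}\mid \mathrm{Hom}_{\mathscr{T}}(S,\Sigma^{n}X)=0 \text{ for all } S\in\mathscr{S} \text{ and } n>0\},\qquad \mathscr{A}=\Sigma({}^{\perp}\mathscr{B}),$$ is a co-$t$-structure of finite type on $\mathscr{T}$.
   Context: An object $S$ of $\mathscr{T}$ is compact if for every set indexed family $\{X_i\}_{i\in I}$ of objects of $\mathscr{T}$ one has the natural isomorphism $\mathrm{Hom}_{\mathscr{T}}(S,\coprod_{i\in I}X_i)\cong\coprod_{i\in I}\mathrm{Hom}_{\mathscr{T}}(S,X_i)$. For a full subcategory $\mathscr{B}$ of $\mathscr{T}$, ${}^{\perp}\mathscr{B}$ is the full subcategory of objects $X$ with $\mathrm{Hom}_{\mathscr{T}}(X,B)=0$ for all $B\in\mathscr{B}$, and $\Sigma({}^{\perp}\mathscr{B})$ is the full subcategory of objects $X$ with $\Sigma^{-1}X\in{}^{\perp}\mathscr{B}$. A pair $(\mathscr{A},\mathscr{B})$ of full subcategories of $\mathscr{T}$ is a co-$t$-structure on $\mathscr{T}$ if: (0) $\mathscr{A}$ and $\mathscr{B}$ are closed under direct summands; (1) $\Sigma^{-1}\mathscr{A}\subseteq\mathscr{A}$ and $\Sigma\mathscr{B}\subseteq\mathscr{B}$; (2) $\mathrm{Hom}_{\mathscr{T}}(\Sigma^{-1}A,B)=0$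 for all $A\in\mathscr{A}$, $B\in\mathscr{B}$; (3) for every object $X$ of $\mathscr{T}$ there is a distinguished triangle $\Sigma^{-1}A\to X\to B\to A$ with $A\in\mathscr{A}$ and $B\in\mathscr{B}$. A co-$t$-structure $(\mathscr{A},\mathscr{B})$ is of finite type if $\mathscr{B}$ is closed under set indexed coproducts. *)

theory Defs
  imports "HOL-Algebra.Free_Abelian_Groups" "HOL-Library.Equipollence" "HOL-Library.Countable_Set"
begin

section \<open>Categories\<close>

record ('o, 'm) precat =
  obj :: "'o set"
  arr :: "'m set"
  src :: "'m \<Rightarrow> 'o"
  tgt :: "'m \<Rightarrow> 'o"
  ide :: "'o \<Rightarrow> 'm"
  cmp :: "'m \<Rightarrow> 'm \<Rightarrow> 'm"  (infixr \<open>\<cdot>\<index>\<close> 75)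

definition Hom :: "('o, 'm, 'z) precat_scheme \<Rightarrow> 'o \<Rightarrow> 'o \<Rightarrow> 'm set" where
  "Hom C X Y = {f \<in> arr C. src C f = X \<and> tgt C f = Y}"

locale cat =
  fixes C :: "('o, 'm, 'z) precat_scheme" (structure)
  assumes src_obj: "f \<in> arr C \<Longrightarrow> src C f \<in> obj C"
    and tgt_obj: "f \<in> arr C \<Longrightarrow> tgt C f \<in> obj C"
    and ide_Hom: "X \<in> obj C \<Longrightarrow> ide C X \<in> Hom C X X"
    and cmp_Hom: "\<lbrakk>f \<in> Hom C X Y; g \<in> Hom C Y Z\<rbrakk> \<Longrightarrow> g \<cdot> f \<in> Hom C X Z"
    and cmp_assoc: "\<lbrakk>f \<in> Hom C X Y; g \<in> Hom C Y Z; h \<in> Hom C Z W\<rbrakk> \<Longrightarrow> (h \<cdot> g) \<cdot> f = h \<cdot> (g \<cdot> f)"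
    and cmp_ide_right: "f \<in> Hom C X Y \<Longrightarrow> f \<cdot> ide C X = f"
    and cmp_ide_left: "f \<in> Hom C X Y \<Longrightarrow> ide C Y \<cdot> f = f"

definition iso_arr :: "('o, 'm, 'z) precat_scheme \<Rightarrow> 'o \<Rightarrow> 'o \<Rightarrow> 'm \<Rightarrow> bool" where
  "iso_arr C X Y f \<longleftrightarrow> f \<in> Hom C X Y \<and>
     (\<exists>g \<in> Hom C Y X. cmp C g f = ide C X \<and> cmp C f g = ide C Y)"

definition zero_object :: "('o, 'm, 'z) precat_scheme \<Rightarrow> 'o \<Rightarrow> bool" where
  "zero_object C Z \<longleftrightarrow> Z \<in> obj C \<and>
     (\<forall>X \<in> obj C. (\<exists>!f. f \<in> Hom C Z X) \<and> (\<exists>!f. f \<in> Hom C X Z))"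

definition is_coproduct ::
  "('o, 'm, 'z) precat_scheme \<Rightarrow> 'i set \<Rightarrow> ('i \<Rightarrow> 'o) \<Rightarrow> 'o \<Rightarrow> ('i \<Rightarrow> 'm) \<Rightarrow> bool" where
  "is_coproduct C I X P \<iota> \<longleftrightarrow> P \<in> obj C \<and> (\<forall>i\<in>I. \<iota> i \<in> Hom C (X i) P) \<and>
     (\<forall>Y \<in> obj C. \<forall>f. (\<forall>i\<in>I. f i \<in> Hom C (X i) Y) \<longrightarrow>
        (\<exists>!h. h \<in> Hom C P Y \<and> (\<forall>i\<in>I. cmp C h (\<iota> i) = f i)))"

section \<open>Additive categories\<close>

record ('o, 'm) preadd_cat = "('o, 'm) precat" +
  add_arr :: "'m \<Rightarrow> 'm \<Rightarrow> 'm"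
  zero_arr :: "'o \<Rightarrow> 'o \<Rightarrow> 'm"

definition Hom_group :: "('o, 'm, 'z) preadd_cat_scheme \<Rightarrow> 'o \<Rightarrow> 'o \<Rightarrow> 'm monoid" where
  "Hom_group C X Y = \<lparr>carrier = Hom C X Y, monoid.mult = add_arr C, one = zero_arr C X Y\<rparr>"

definition neg_arr :: "('o, 'm, 'z) preadd_cat_scheme \<Rightarrow> 'm \<Rightarrow> 'm" where
  "neg_arr C f = m_inv (Hom_group C (src C f) (tgt C f)) f"

locale additive_cat = cat C for C :: "('o, 'm, 'z) preadd_cat_scheme" (structure) +
  assumes Hom_comm_group: "\<lbrakk>X \<in> obj C; Y \<in> obj C\<rbrakk> \<Longrightarrow> comm_group (Hom_group C X Y)"
    and cmp_add_right: "\<lbrakk>f \<in> Hom C X Y; f' \<in> Hom C X Y; g \<in> Hom C Y Z\<rbrakk> \<Longrightarrow>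
      g \<cdot> add_arr C f f' = add_arr C (g \<cdot> f) (g \<cdot> f')"
    and cmp_add_left: "\<lbrakk>f \<in> Hom C X Y; g \<in> Hom C Y Z; g' \<in> Hom C Y Z\<rbrakk> \<Longrightarrow>
      add_arr C g g' \<cdot> f = add_arr C (g \<cdot> f) (g' \<cdot> f)"
    and ex_zero_object: "\<exists>Z. zero_object C Z"
    and ex_binary_coproduct: "\<lbrakk>X \<in> obj C; Y \<in> obj C\<rbrakk> \<Longrightarrow>
      \<exists>P \<iota>. is_coproduct C (UNIV :: bool set) (\<lambda>b. if b then X else Y) P \<iota>"

section \<open>Triangulated categories\<close>

text \<open>
  As in Verdier's and Neeman's definitions, the suspension is an automorphism of the category,
  so that its inverse is literally defined on objects.  A member \<open>(f, g, h)\<close> of \<open>dist\<close> stands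
  for a distinguished triangle \<open>X \<rightarrow> Y \<rightarrow> Z \<rightarrow> \<Sigma> X\<close>; the objects are determined by the arrows.
\<close>

record ('o, 'm) pretri_cat = "('o, 'm) preadd_cat" +
  susp :: "'o \<Rightarrow> 'o"
  susp_arr :: "'m \<Rightarrow> 'm"
  dist :: "('m \<times> 'm \<times> 'm) set"

definition desusp :: "('o, 'm, 'z) pretri_cat_scheme \<Rightarrow> 'o \<Rightarrow> 'o" where
  "desusp T = inv_into (obj T) (susp T)"

definition is_triangle ::
  "('o, 'm, 'z) pretri_cat_scheme \<Rightarrow> 'o \<Rightarrow> 'o \<Rightarrow> 'o \<Rightarrow> 'm \<Rightarrow> 'm \<Rightarrow> 'm \<Rightarrow> bool" where
  "is_triangle T X Y Z f g h \<longleftrightarrow>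
     X \<in> obj T \<and> Y \<in> obj T \<and> Z \<in> obj T \<and>
     f \<in> Hom T X Y \<and> g \<in> Hom T Y Z \<and> h \<in> Hom T Z (susp T X)"

definition dist_triangle ::
  "('o, 'm, 'z) pretri_cat_scheme \<Rightarrow> 'o \<Rightarrow> 'o \<Rightarrow> 'o \<Rightarrow> 'm \<Rightarrow> 'm \<Rightarrow> 'm \<Rightarrow> bool" where
  "dist_triangle T X Y Z f g h \<longleftrightarrow> is_triangle T X Y Z f g h \<and> (f, g, h) \<in> dist T"

locale triangulated_cat = additive_cat T
  for T :: "('o, 'm, 'z) pretri_cat_scheme" (structure) +
  assumes susp_bij: "bij_betw (susp T) (obj T) (obj T)"
    and susp_arr_bij: "bij_betw (susp_arr T) (arr T) (arr T)"
    and susp_arr_Hom: "f \<in> Hom T X Y \<Longrightarrow> susp_arr T f \<in> Hom T (susp T X) (susp T Y)"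
    and susp_arr_ide: "X \<in> obj T \<Longrightarrow> susp_arr T (ide T X) = ide T (susp T X)"
    and susp_arr_cmp: "\<lbrakk>f \<in> Hom T X Y; g \<in> Hom T Y Z\<rbrakk> \<Longrightarrow>
      susp_arr T (g \<cdot> f) = susp_arr T g \<cdot> susp_arr T f"
    and susp_arr_add: "\<lbrakk>f \<in> Hom T X Y; g \<in> Hom T X Y\<rbrakk> \<Longrightarrow>
      susp_arr T (add_arr T f g) = add_arr T (susp_arr T f) (susp_arr T g)"
    and dist_is_triangle: "(f, g, h) \<in> dist T \<Longrightarrow> \<exists>X Y Z. is_triangle T X Y Z f g h"
    and dist_iso: "\<lbrakk>dist_triangle T X Y Z f g h; is_triangle T X' Y' Z' f' g' h';
      iso_arr T X X' a; iso_arr T Y Y' b; iso_arr T Z Z' c;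
      b \<cdot> f = f' \<cdot> a; c \<cdot> g = g' \<cdot> b; susp_arr T a \<cdot> h = h' \<cdot> c\<rbrakk> \<Longrightarrow>
      dist_triangle T X' Y' Z' f' g' h'"
    and dist_ide: "\<lbrakk>X \<in> obj T; zero_object T Z\<rbrakk> \<Longrightarrow>
      dist_triangle T X X Z (ide T X) (zero_arr T X Z) (zero_arr T Z (susp T X))"
    and dist_complete: "f \<in> Hom T X Y \<Longrightarrow> \<exists>Z g h. dist_triangle T X Y Z f g h"
    and dist_rotate: "is_triangle T X Y Z f g h \<Longrightarrow>
      dist_triangle T X Y Z f g h \<longleftrightarrow>
      dist_triangle T Y Z (susp T X) g h (neg_arr T (susp_arr T f))"
    and dist_fill: "\<lbrakk>dist_triangle T X Y Z f g h; dist_triangle T X' Y' Z' f' g' h';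
      a \<in> Hom T X X'; b \<in> Hom T Y Y'; b \<cdot> f = f' \<cdot> a\<rbrakk> \<Longrightarrow>
      \<exists>c \<in> Hom T Z Z'. c \<cdot> g = g' \<cdot> b \<and> susp_arr T a \<cdot> h = h' \<cdot> c"
    and octahedral: "\<lbrakk>dist_triangle T X Y C\<^sub>f f u v; dist_triangle T Y Z C\<^sub>g g p q;
      dist_triangle T X Z C\<^sub>h (g \<cdot> f) r s\<rbrakk> \<Longrightarrow>
      \<exists>a b. dist_triangle T C\<^sub>f C\<^sub>h C\<^sub>g a b (susp_arr T u \<cdot> q) \<and>
        a \<cdot> u = r \<cdot> g \<and> s \<cdot> a = v \<and> b \<cdot> r = p \<and> q \<cdot> b = susp_arr T f \<cdot> s"

section \<open>Set indexed coproducts and compact objects\<close>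

text \<open>
  The objects of \<open>T\<close> may form a proper class, whereas index families are indexed by sets.  This
  is rendered relative to a type \<open>'u\<close>: the small sets (of any type) are those of cardinality less
  than that of \<open>'u\<close>.  If the cardinality of \<open>'u\<close> is strongly inaccessible, these are, up to
  bijection, the members of a Grothendieck universe.  Every small set is in bijection with a
  small set of elements of \<open>'u\<close>, so only the latter are needed as index sets.

  Smallness of all Hom-sets is deliberately not built into the notion of category.  By Freyd's
  argument it would, together with small coproducts, force a triangulated category to be zero
  unless the cardinality of \<open>'u\<close> is strongly inaccessible (or countable), and HOL proves no type
  to have such a cardinality.  So smallness should be assumed just of the Hom-sets that matter,
  with \<open>'u\<close> uncountable in order that the set of natural numbers be small.
\<close>

definition small :: "'u itself \<Rightarrow> 'a set \<Rightarrow> bool" where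
  "small _ A \<longleftrightarrow> A \<prec> (UNIV :: 'u set)"

definition has_small_coproducts :: "'u itself \<Rightarrow> ('o, 'm, 'z) precat_scheme \<Rightarrow> bool" where
  "has_small_coproducts U C \<longleftrightarrow>
     (\<forall>(I :: 'u set) X. small U I \<longrightarrow> (\<forall>i\<in>I. X i \<in> obj C) \<longrightarrow> (\<exists>P \<iota>. is_coproduct C I X P \<iota>))"

definition closed_small_coproducts ::
  "'u itself \<Rightarrow> ('o, 'm, 'z) precat_scheme \<Rightarrow> 'o set \<Rightarrow> bool" where
  "closed_small_coproducts U C \<B> \<longleftrightarrow>
     (\<forall>(I :: 'u set) X P \<iota>. small U I \<longrightarrow> (\<forall>i\<in>I. X i \<in> \<B>) \<longrightarrow> is_coproduct C I X P \<iota> \<longrightarrow> P \<in> \<B>)"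

text \<open>
  \<open>sum_group\<close> is the direct sum of groups, and \<open>gfinprod\<close> the sum (in the commutative group
  written multiplicatively) of a finitely supported family.  So the map below is the canonical
  one from the direct sum of the \<open>Hom(S, X\<^sub>i)\<close> to \<open>Hom(S, P)\<close>.
\<close>

definition compact_object ::
  "'u itself \<Rightarrow> ('o, 'm, 'z) preadd_cat_scheme \<Rightarrow> 'o \<Rightarrow> bool" where
  "compact_object U C S \<longleftrightarrow> S \<in> obj C \<and>
     (\<forall>(I :: 'u set) X P \<iota>. small U I \<longrightarrow> (\<forall>i\<in>I. X i \<in> obj C) \<longrightarrow> is_coproduct C I X P \<iota> \<longrightarrow>
        (\<lambda>x. gfinprod (Hom_group C S P) (\<lambda>i. cmp C (\<iota> i) (x i)) I)
          \<in> iso (sum_group I (\<lambda>i. Hom_group C S (X i))) (Hom_group C S P))"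

section \<open>Co-t-structures\<close>

text \<open>Full subcategories are represented by their sets of objects.\<close>

definition left_perp :: "('o, 'm, 'z) preadd_cat_scheme \<Rightarrow> 'o set \<Rightarrow> 'o set" where
  "left_perp C \<B> = {X \<in> obj C. \<forall>B\<in>\<B>. Hom C X B = {zero_arr C X B}}"

definition susp_subcat :: "('o, 'm, 'z) pretri_cat_scheme \<Rightarrow> 'o set \<Rightarrow> 'o set" where
  "susp_subcat T \<X> = {X \<in> obj T. desusp T X \<in> \<X>}"

definition closed_summands :: "('o, 'm, 'z) precat_scheme \<Rightarrow> 'o set \<Rightarrow> bool" where
  "closed_summands C \<X> \<longleftrightarrow>
     (\<forall>X Y Y' \<iota>. X \<in> \<X> \<longrightarrow> Y \<in> obj C \<longrightarrow> Y' \<in> obj C \<longrightarrow>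
        is_coproduct C (UNIV :: bool set) (\<lambda>b. if b then Y else Y') X \<iota> \<longrightarrow> Y \<in> \<X>)"

definition co_t_structure ::
  "('o, 'm, 'z) pretri_cat_scheme \<Rightarrow> 'o set \<Rightarrow> 'o set \<Rightarrow> bool" where
  "co_t_structure T \<A> \<B> \<longleftrightarrow>
     \<A> \<subseteq> obj T \<and> \<B> \<subseteq> obj T \<and>
     closed_summands T \<A> \<and> closed_summands T \<B> \<and>
     desusp T ` \<A> \<subseteq> \<A> \<and> susp T ` \<B> \<subseteq> \<B> \<and>
     (\<forall>A\<in>\<A>. \<forall>B\<in>\<B>. Hom T (desusp T A) B = {zero_arr T (desusp T A) B}) \<and>
     (\<forall>X \<in> obj T. \<exists>A\<in>\<A>. \<exists>B\<in>\<B>. \<exists>f g h. h \<in> Hom T B A \<and> dist_triangle T (desusp T A) X B f g h)"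

definition finite_type_co_t_structure ::
  "'u itself \<Rightarrow> ('o, 'm, 'z) pretri_cat_scheme \<Rightarrow> 'o set \<Rightarrow> 'o set \<Rightarrow> bool" where
  "finite_type_co_t_structure U T \<A> \<B> \<longleftrightarrow>
     co_t_structure T \<A> \<B> \<and> closed_small_coproducts U T \<B>"

end

theory Submission
  imports Defs
begin

text \<open>
  Let \<open>\<G>\<close> consist of the objects \<open>\<Sigma>\<^sup>-\<^sup>nS\<close> with \<open>S \<in> \<S>\<close> and \<open>n > 0\<close>, so that \<open>\<B>\<close> is the class of objects
  receiving no nonzero maps from \<open>\<G>\<close>.  For any \<open>X\<close>, a coproduct \<open>W\<close> of objects of \<open>\<G>\<close> maps to \<open>X\<close> such
  that every map from a member of \<open>\<G>\<close> to \<open>X\<close> factors through \<open>W\<close>; pass to the cone of \<open>W \<rightarrow> X\<close>,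
  and iterate.  The homotopy colimit \<open>B\<close> of the resulting sequence lies in \<open>\<B>\<close> by compactness.  Each
  step, and therefore \<open>X \<rightarrow> B\<close>, has the property that maps from \<open>X\<close> to members of \<open>\<B>\<close> extend, and that
  maps to suspensions of members of \<open>\<B>\<close> vanish if they vanish on \<open>X\<close>.  By the long exact sequence
  the cocone of \<open>X \<rightarrow> B\<close> then has no nonzero maps to \<open>\<B>\<close>.
\<close>

section \<open>Coproducts and small index sets in an arbitrary category\<close>

context cat
begin

lemma Hom_obj: "f \<in> Hom C X Y \<Longrightarrow> X \<in> obj C" "f \<in> Hom C X Y \<Longrightarrow> Y \<in> obj C"
  using src_obj tgt_obj unfolding Hom_def by auto

lemma coproduct_universal:
  assumes "is_coproduct C I X P \<iota>" "Y \<in> obj C" "\<forall>i\<in>I. f i \<in> Hom C (X i) Y"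
  shows "\<exists>!h. h \<in> Hom C P Y \<and> (\<forall>i\<in>I. h \<cdot> \<iota> i = f i)"
proof -
  have "\<forall>Y \<in> obj C. \<forall>f. (\<forall>i\<in>I. f i \<in> Hom C (X i) Y) \<longrightarrow>
      (\<exists>!h. h \<in> Hom C P Y \<and> (\<forall>i\<in>I. h \<cdot> \<iota> i = f i))"
    using assms(1) unfolding is_coproduct_def by (elim conjE)
  from this[rule_format, OF assms(2), of f] show ?thesis using assms(3) by simp
qed

text \<open>\<open>has_small_coproducts\<close> and \<open>compact_object\<close> speak of index
  sets inside the type \<open>'u\<close>. Transport along a bijection makes \<open>\<S>\<close>,
  sets of numbers and Hom-sets available as index sets.\<close>

lemma is_coproduct_reindex:
  assumes "is_coproduct C I X P \<iota>" "bij_betw e J I"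
    and "\<And>j. j \<in> J \<Longrightarrow> X (e j) = X' j" "\<And>j. j \<in> J \<Longrightarrow> \<iota> (e j) = \<iota>' j"
  shows "is_coproduct C J X' P \<iota>'"
  unfolding is_coproduct_def
proof (intro conjI ballI allI impI)
  have eI: "e j \<in> I" if "j \<in> J" for j
    using assms(2) that by (auto simp: bij_betw_def)
  show "P \<in> obj C" using assms(1) by (simp add: is_coproduct_def)
  show "\<iota>' j \<in> Hom C (X' j) P" if "j \<in> J" for j
    using assms(1) assms(3,4)[OF that] eI[OF that] unfolding is_coproduct_def by metis
  fix Y f assume Y: "Y \<in> obj C" and f: "\<forall>j\<in>J. f j \<in> Hom C (X' j) Y"
  define e' where "e' = inv_into J e"
  have e': "e' i \<in> J" "e (e' i) = i" if "i \<in> I" for i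
    using assms(2) that unfolding e'_def
    by (auto simp: bij_betw_def inv_into_into f_inv_into_f)
  have e'e: "e' (e j) = j" if "j \<in> J" for j
    using assms(2) that unfolding e'_def by (auto simp: bij_betw_def)
  have "\<forall>i\<in>I. f (e' i) \<in> Hom C (X i) Y"
    using f e' assms(3) by metis
  then have "\<exists>!h. h \<in> Hom C P Y \<and> (\<forall>i\<in>I. h \<cdot> \<iota> i = f (e' i))"
    by (rule coproduct_universal[OF assms(1) Y])
  moreover have "(\<forall>i\<in>I. h \<cdot> \<iota> i = f (e' i)) \<longleftrightarrow> (\<forall>j\<in>J. h \<cdot> \<iota>' j = f j)" for h
    using e' e'e eI assms(4) by metis
  ultimately show "\<exists>!h. h \<in> Hom C P Y \<and> (\<forall>j\<in>J. h \<cdot> \<iota>' j = f j)"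
    by simp
qed

text \<open>A small set injects into \<open>'u\<close> with small image; the coproduct over the
  image, of the family pulled back along the inverse, is reindexed by the injection.\<close>

lemma small_coproduct:
  assumes "has_small_coproducts TYPE('u) C" "small TYPE('u) J" "\<And>j. j \<in> J \<Longrightarrow> X j \<in> obj C"
  shows "\<exists>P \<iota>. is_coproduct C J X P \<iota>"
proof -
  have "J \<lesssim> (UNIV :: 'u set)"
    using assms(2) by (simp add: small_def lesspoll_def)
  then obtain e :: "'a \<Rightarrow> 'u" where e: "inj_on e J"
    by (auto simp: lepoll_def)
  have bij: "bij_betw e J (e ` J)" using e by (simp add: bij_betw_def)
  have "e ` J \<lesssim> J" by (rule image_lepoll)
  then have "small TYPE('u) (e ` J)"
    using assms(2) unfolding small_def by (rule lesspoll_trans1)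
  moreover have "\<forall>i \<in> e ` J. X (inv_into J e i) \<in> obj C"
    using assms(3) by (metis inv_into_into)
  ultimately obtain P \<iota> where "is_coproduct C (e ` J) (X \<circ> inv_into J e) P \<iota>"
    using assms(1) unfolding has_small_coproducts_def by fastforce
  then have "is_coproduct C J X P (\<iota> \<circ> e)"
    by (rule is_coproduct_reindex[OF _ bij]) (auto simp: e)
  then show ?thesis by blast
qed

lemma coproduct_inj:
  assumes "is_coproduct C I X P \<iota>" "i \<in> I"
  shows "\<iota> i \<in> Hom C (X i) P"
  using assms by (simp add: is_coproduct_def)

lemma coproduct_map_ext:
  assumes "is_coproduct C I X P \<iota>" "h \<in> Hom C P Y" "h' \<in> Hom C P Y"
    and "\<And>i. i \<in> I \<Longrightarrow> h \<cdot> \<iota> i = h' \<cdot> \<iota> i"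
  shows "h = h'"
proof -
  have "\<forall>i\<in>I. h \<cdot> \<iota> i \<in> Hom C (X i) Y"
    using cmp_Hom[OF coproduct_inj[OF assms(1)] assms(2)] by simp
  then have "\<exists>!k. k \<in> Hom C P Y \<and> (\<forall>i\<in>I. k \<cdot> \<iota> i = h \<cdot> \<iota> i)"
    by (rule coproduct_universal[OF assms(1) Hom_obj(2)[OF assms(2)]])
  then show ?thesis using assms by metis
qed

lemma coproduct_map:
  assumes "is_coproduct C I X P \<iota>" "Y \<in> obj C" "\<And>i. i \<in> I \<Longrightarrow> f i \<in> Hom C (X i) Y"
  obtains h where "h \<in> Hom C P Y" "\<And>i. i \<in> I \<Longrightarrow> h \<cdot> \<iota> i = f i"
  using coproduct_universal[OF assms(1,2), of f] assms(3) by blast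

end

text \<open>This is where uncountability of \<open>'u\<close> enters: sequences and sets of
  exponents become admissible index sets.\<close>

lemma nat_small:
  fixes A :: "nat set"
  assumes "uncountable (UNIV :: 'u set)"
  shows "small TYPE('u) A"
proof -
  have "infinite (UNIV :: 'u set)"
    using assms countable_finite by auto
  then have "(UNIV :: nat set) \<lesssim> (UNIV :: 'u set)"
    by (simp add: infinite_le_lepoll)
  then have "A \<lesssim> (UNIV :: 'u set)"
    by (rule lepoll_trans[OF subset_imp_lepoll[OF subset_UNIV]])
  moreover have "\<not> (UNIV :: 'u set) \<approx> A"
    using assms countable_eqpoll[of A "UNIV :: 'u set"] by auto
  ultimately show ?thesis
    using eqpoll_sym by (auto simp: small_def lesspoll_def)
qed

lemma small_lepoll: "small TYPE('u) B \<Longrightarrow> A \<lesssim> B \<Longrightarrow> small TYPE('u) A"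
  unfolding small_def by (rule lesspoll_trans1)

section \<open>Arithmetic of arrows in an additive category\<close>

context additive_cat
begin

lemma zero_Hom:
  assumes "X \<in> obj C" "Y \<in> obj C"
  shows "zero_arr C X Y \<in> Hom C X Y"
proof -
  interpret H: comm_group "Hom_group C X Y" using Hom_comm_group[OF assms] .
  show ?thesis using H.one_closed by (simp add: Hom_group_def)
qed

lemma neg_Hom:
  assumes "f \<in> Hom C X Y"
  shows "neg_arr C f \<in> Hom C X Y" "add_arr C (neg_arr C f) f = zero_arr C X Y"
proof -
  interpret H: comm_group "Hom_group C X Y" using Hom_comm_group Hom_obj assms by blast
  have "src C f = X" "tgt C f = Y" using assms by (auto simp: Hom_def)
  then show "neg_arr C f \<in> Hom C X Y" "add_arr C (neg_arr C f) f = zero_arr C X Y"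
    using H.inv_closed[of f] H.l_inv[of f] assms by (auto simp: neg_arr_def Hom_group_def)
qed

lemma add_zero_left:
  assumes "f \<in> Hom C X Y"
  shows "add_arr C (zero_arr C X Y) f = f"
proof -
  interpret H: comm_group "Hom_group C X Y" using Hom_comm_group Hom_obj assms by blast
  show ?thesis using H.l_one[of f] assms by (simp add: Hom_group_def)
qed

lemma add_commute:
  assumes "f \<in> Hom C X Y" "g \<in> Hom C X Y"
  shows "add_arr C f g = add_arr C g f"
proof -
  interpret H: comm_group "Hom_group C X Y" using Hom_comm_group Hom_obj assms by blast
  show ?thesis using H.m_comm[of f g] assms by (simp add: Hom_group_def)
qed

lemma add_zero_right:
  assumes "f \<in> Hom C X Y"
  shows "add_arr C f (zero_arr C X Y) = f"
proof -
  interpret H: comm_group "Hom_group C X Y" using Hom_comm_group Hom_obj assms by blast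
  show ?thesis using H.r_one[of f] assms by (simp add: Hom_group_def)
qed

lemma add_cancel_right:
  assumes "f \<in> Hom C X Y" "f' \<in> Hom C X Y" "g \<in> Hom C X Y"
    and "add_arr C f g = add_arr C f' g"
  shows "f = f'"
proof -
  interpret H: comm_group "Hom_group C X Y" using Hom_comm_group Hom_obj assms by blast
  show ?thesis using H.right_cancel[of g f f'] assms by (simp add: Hom_group_def)
qed

text \<open>A difference is described by the equation that it satisfies. The map
  \<open>id - s\<close> defining the homotopy colimit is obtained in this form.\<close>

lemma ex_diff:
  assumes "f \<in> Hom C X Y" "g \<in> Hom C X Y"
  obtains d where "d \<in> Hom C X Y" "add_arr C d g = f"
proof -
  interpret H: comm_group "Hom_group C X Y" using Hom_comm_group Hom_obj assms by blast
  have "f \<otimes>\<^bsub>Hom_group C X Y\<^esub> (inv\<^bsub>Hom_group C X Y\<^esub> g \<otimes>\<^bsub>Hom_group C X Y\<^esub> g) = f"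
    using H.l_inv[of g] H.r_one[of f] assms by (simp add: Hom_group_def)
  then have "(f \<otimes>\<^bsub>Hom_group C X Y\<^esub> inv\<^bsub>Hom_group C X Y\<^esub> g) \<otimes>\<^bsub>Hom_group C X Y\<^esub> g = f"
    using H.m_assoc[of f "inv\<^bsub>Hom_group C X Y\<^esub> g" g] H.inv_closed[of g] assms
    by (simp add: Hom_group_def)
  moreover have "f \<otimes>\<^bsub>Hom_group C X Y\<^esub> inv\<^bsub>Hom_group C X Y\<^esub> g \<in> carrier (Hom_group C X Y)"
    using assms H.inv_closed[of g] by (intro H.m_closed) (auto simp: Hom_group_def)
  ultimately show thesis using that by (simp add: Hom_group_def)
qed

text \<open>The neutral element is the only idempotent of a group. Hence composition and suspension
  preserve zero maps as soon as they are additive.\<close>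

lemma idem_zero:
  assumes "f \<in> Hom C X Y" "add_arr C f f = f"
  shows "f = zero_arr C X Y"
  using add_cancel_right[OF assms(1) _ assms(1), of "zero_arr C X Y"] add_zero_left zero_Hom
    Hom_obj assms by metis

lemma cmp_zero_right:
  assumes "g \<in> Hom C Y Z" "X \<in> obj C"
  shows "g \<cdot> zero_arr C X Y = zero_arr C X Z"
proof (rule idem_zero)
  have z: "zero_arr C X Y \<in> Hom C X Y" using assms zero_Hom Hom_obj by blast
  show "g \<cdot> zero_arr C X Y \<in> Hom C X Z" using cmp_Hom[OF z assms(1)] .
  show "add_arr C (g \<cdot> zero_arr C X Y) (g \<cdot> zero_arr C X Y) = g \<cdot> zero_arr C X Y"
    using cmp_add_right[OF z z assms(1)] add_zero_left[OF z] by simp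
qed

lemma cmp_zero_left:
  assumes "f \<in> Hom C X Y" "Z \<in> obj C"
  shows "zero_arr C Y Z \<cdot> f = zero_arr C X Z"
proof (rule idem_zero)
  have z: "zero_arr C Y Z \<in> Hom C Y Z" using assms zero_Hom Hom_obj by blast
  show "zero_arr C Y Z \<cdot> f \<in> Hom C X Z" using cmp_Hom[OF assms(1) z] .
  show "add_arr C (zero_arr C Y Z \<cdot> f) (zero_arr C Y Z \<cdot> f) = zero_arr C Y Z \<cdot> f"
    using cmp_add_left[OF assms(1) z z] add_zero_left[OF z] by simp
qed

lemma neg_zero:
  assumes "X \<in> obj C" "Y \<in> obj C"
  shows "neg_arr C (zero_arr C X Y) = zero_arr C X Y"
  using neg_Hom[OF zero_Hom[OF assms]] add_zero_right by metis

lemma neg_neg: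
  assumes "f \<in> Hom C X Y"
  shows "neg_arr C (neg_arr C f) = f"
proof -
  interpret H: comm_group "Hom_group C X Y" using Hom_comm_group Hom_obj assms by blast
  have "src C f = X" "tgt C f = Y" "src C (neg_arr C f) = X" "tgt C (neg_arr C f) = Y"
    using assms neg_Hom(1)[OF assms] by (auto simp: Hom_def)
  then show ?thesis using H.inv_inv[of f] assms by (simp add: neg_arr_def Hom_group_def)
qed

lemma neg_inj:
  assumes "f \<in> Hom C X Y" "g \<in> Hom C X' Y'" "neg_arr C f = neg_arr C g"
  shows "f = g"
  using neg_neg[OF assms(1)] neg_neg[OF assms(2)] assms(3) by argo

lemma neg_cmp_left:
  assumes "f \<in> Hom C X Y" "g \<in> Hom C Y Z"
  shows "neg_arr C g \<cdot> f = neg_arr C (g \<cdot> f)"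
proof (rule add_cancel_right)
  show "neg_arr C g \<cdot> f \<in> Hom C X Z" "neg_arr C (g \<cdot> f) \<in> Hom C X Z" "g \<cdot> f \<in> Hom C X Z"
    using assms cmp_Hom neg_Hom(1) by blast+
  show "add_arr C (neg_arr C g \<cdot> f) (g \<cdot> f) = add_arr C (neg_arr C (g \<cdot> f)) (g \<cdot> f)"
    using neg_Hom[OF assms(2)] neg_Hom(2)[OF cmp_Hom[OF assms]] cmp_add_left[OF assms(1) _ assms(2)]
      cmp_zero_left[OF assms(1)] Hom_obj(2)[OF assms(2)] by metis
qed

lemma neg_cmp_right:
  assumes "f \<in> Hom C X Y" "g \<in> Hom C Y Z"
  shows "g \<cdot> neg_arr C f = neg_arr C (g \<cdot> f)"
proof (rule add_cancel_right)
  show "g \<cdot> neg_arr C f \<in> Hom C X Z" "neg_arr C (g \<cdot> f) \<in> Hom C X Z" "g \<cdot> f \<in> Hom C X Z"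
    using assms cmp_Hom neg_Hom(1) by blast+
  show "add_arr C (g \<cdot> neg_arr C f) (g \<cdot> f) = add_arr C (neg_arr C (g \<cdot> f)) (g \<cdot> f)"
    using neg_Hom[OF assms(1)] neg_Hom(2)[OF cmp_Hom[OF assms]] cmp_add_right[OF _ assms(1) assms(2)]
      cmp_zero_right[OF assms(2)] Hom_obj(1)[OF assms(1)] by metis
qed

lemma Hom_zero_iff:
  assumes "X \<in> obj C" "Y \<in> obj C"
  shows "Hom C X Y = {zero_arr C X Y} \<longleftrightarrow> (\<forall>f \<in> Hom C X Y. f = zero_arr C X Y)"
  using zero_Hom[OF assms] by auto

text \<open>The projection is induced by the identity of \<open>Y\<close> and the zero map of
  \<open>Y'\<close>. Closure under direct summands is later deduced from this retraction.\<close>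

lemma summand_retract:
  assumes "is_coproduct C (UNIV :: bool set) (\<lambda>b. if b then Y else Y') X \<iota>" "Y \<in> obj C" "Y' \<in> obj C"
  obtains i p where "i \<in> Hom C Y X" "p \<in> Hom C X Y" "p \<cdot> i = ide C Y"
proof -
  obtain p where p: "p \<in> Hom C X Y"
      "\<And>b. p \<cdot> \<iota> b = (if b then ide C Y else zero_arr C Y' Y)"
  proof (rule coproduct_map[OF assms(1,2)])
    show "(if b then ide C Y else zero_arr C Y' Y) \<in> Hom C (if b then Y else Y') Y" for b
      using ide_Hom zero_Hom assms(2,3) by simp
  qed auto
  show thesis
    using that[of "\<iota> True" p] coproduct_inj[OF assms(1), of True] p(1) p(2)[of True] by simp
qed

end

section \<open>Compactness, left orthogonals and covers by coproducts\<close>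

text \<open>The only consequence of compactness that the proof needs.\<close>

definition weakly_compact ::
  "'u itself \<Rightarrow> ('o, 'm, 'z) preadd_cat_scheme \<Rightarrow> 'o \<Rightarrow> bool" where
  "weakly_compact U C G \<longleftrightarrow> G \<in> obj C \<and>
     (\<forall>(I :: 'u set) X P \<iota> Z h. small U I \<longrightarrow> is_coproduct C I X P \<iota> \<longrightarrow> h \<in> Hom C P Z \<longrightarrow>
        (\<forall>i\<in>I. \<forall>y \<in> Hom C G (X i). cmp C h (cmp C (\<iota> i) y) = zero_arr C G Z) \<longrightarrow>
        (\<forall>x \<in> Hom C G P. cmp C h x = zero_arr C G Z))"

context additive_cat
begin

text \<open>Surjectivity of the canonical map writes \<open>x\<close> as a finite sum of maps
  through single summands; \<open>h\<close> kills each term, hence by additivity the sum.\<close>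

lemma compact_imp_weakly_compact:
  assumes "compact_object TYPE('u) C S"
  shows "weakly_compact TYPE('u) C S"
  unfolding weakly_compact_def
proof (intro conjI allI impI ballI)
  show S: "S \<in> obj C" using assms by (simp add: compact_object_def)
  fix I :: "'u set" and X P \<iota> Z h x
  assume I: "small TYPE('u) I" and P: "is_coproduct C I X P \<iota>" and h: "h \<in> Hom C P Z"
    and zero: "\<forall>i\<in>I. \<forall>y \<in> Hom C S (X i). h \<cdot> \<iota> i \<cdot> y = zero_arr C S Z" and x: "x \<in> Hom C S P"
  let ?G = "Hom_group C S P"
  have obs: "P \<in> obj C" "Z \<in> obj C" using Hom_obj h by blast+
  interpret H: comm_group ?G using Hom_comm_group[OF S obs(1)] .
  have "\<forall>i\<in>I. X i \<in> obj C" using Hom_obj(1) coproduct_inj[OF P] by blast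
  then have "(\<lambda>x. gfinprod ?G (\<lambda>i. \<iota> i \<cdot> x i) I)
      \<in> iso (sum_group I (\<lambda>i. Hom_group C S (X i))) ?G"
    using assms I P unfolding compact_object_def by blast
  then have "x \<in> (\<lambda>x. gfinprod ?G (\<lambda>i. \<iota> i \<cdot> x i) I) ` carrier (sum_group I (\<lambda>i. Hom_group C S (X i)))"
    using x by (simp add: iso_def bij_betw_def Hom_group_def)
  then obtain y where y: "y \<in> carrier (sum_group I (\<lambda>i. Hom_group C S (X i)))"
      "x = gfinprod ?G (\<lambda>i. \<iota> i \<cdot> y i) I" by blast
  have yi: "y i \<in> Hom C S (X i)" if "i \<in> I" for i
  proof -
    have "group (Hom_group C S (X i))" if "i \<in> I" for i
      using Hom_comm_group[OF S Hom_obj(1)[OF coproduct_inj[OF P that]]] by (rule comm_group.axioms)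
    then have "y \<in> (\<Pi>\<^sub>E i\<in>I. carrier (Hom_group C S (X i)))"
      using y(1) by (subst (asm) carrier_sum_group) auto
    then have "y i \<in> carrier (Hom_group C S (X i))" using that by (rule PiE_mem)
    then show ?thesis by (simp add: Hom_group_def)
  qed
  have m: "\<iota> i \<cdot> y i \<in> Hom C S P" if "i \<in> I" for i
    using cmp_Hom[OF yi[OF that] coproduct_inj[OF P that]] .
  have fin: "h \<cdot> finprod ?G (\<lambda>i. \<iota> i \<cdot> y i) J = zero_arr C S Z" if "finite J" "J \<subseteq> I" for J
    using that
  proof (induction J rule: finite_induct)
    case empty
    have "finprod ?G (\<lambda>i. \<iota> i \<cdot> y i) {} = zero_arr C S P"
      unfolding H.finprod_empty by (simp add: Hom_group_def)
    then show ?case using cmp_zero_right[OF h S] by simp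
  next
    case (insert i J)
    have closed: "finprod ?G (\<lambda>i. \<iota> i \<cdot> y i) J \<in> Hom C S P"
      using H.finprod_closed[of "\<lambda>i. \<iota> i \<cdot> y i" J] insert.prems m by (auto simp: Hom_group_def)
    have "finprod ?G (\<lambda>i. \<iota> i \<cdot> y i) (insert i J)
        = add_arr C (\<iota> i \<cdot> y i) (finprod ?G (\<lambda>i. \<iota> i \<cdot> y i) J)"
      using H.finprod_insert[OF insert.hyps(1,2), of "\<lambda>i. \<iota> i \<cdot> y i"] insert.prems m
      by (auto simp: Hom_group_def)
    then have "h \<cdot> finprod ?G (\<lambda>i. \<iota> i \<cdot> y i) (insert i J)
        = add_arr C (h \<cdot> \<iota> i \<cdot> y i) (h \<cdot> finprod ?G (\<lambda>i. \<iota> i \<cdot> y i) J)"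
      using cmp_add_right[OF m closed h] insert.prems by simp
    also have "\<dots> = zero_arr C S Z"
      using zero yi insert add_zero_left[OF zero_Hom[OF S obs(2)]] by auto
    finally show ?case .
  qed
  \<comment> \<open>\<open>gfinprod\<close> is the product over the support if that is finite and
    the default value \<open>\<one>\<close> otherwise, so the default must be killed by
    \<open>h\<close> as well.\<close>
  have "h \<cdot> \<one>\<^bsub>?G\<^esub> = zero_arr C S Z"
    using cmp_zero_right[OF h S] by (simp add: Hom_group_def)
  then have "h \<cdot> gfinprod ?G (\<lambda>i. \<iota> i \<cdot> y i) I = zero_arr C S Z"
    unfolding gfinprod_def using fin by auto
  then show "h \<cdot> x = zero_arr C S Z" using y(2) by simp
qed

text \<open>Carries the defining property from index sets in \<open>'u\<close> to small index sets
  of any type, by injecting \<open>J\<close> into \<open>'u\<close> and reindexing the coproduct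
  over the image.\<close>

lemma weakly_compactD:
  fixes J :: "'j set"
  assumes "weakly_compact TYPE('u) C G" "small TYPE('u) J" "is_coproduct C J X P \<iota>" "h \<in> Hom C P Z"
    and "\<And>j y. j \<in> J \<Longrightarrow> y \<in> Hom C G (X j) \<Longrightarrow> h \<cdot> \<iota> j \<cdot> y = zero_arr C G Z"
    and "x \<in> Hom C G P"
  shows "h \<cdot> x = zero_arr C G Z"
proof -
  have "J \<lesssim> (UNIV :: 'u set)"
    using assms(2) by (simp add: small_def lesspoll_def)
  then obtain e :: "'j \<Rightarrow> 'u" where e: "inj_on e J"
    by (auto simp: lepoll_def)
  define e' where "e' = inv_into J e"
  have e': "e' i \<in> J" if "i \<in> e ` J" for i
    using that unfolding e'_def by (rule inv_into_into)
  have bij: "bij_betw e' (e ` J) J"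
    unfolding e'_def by (rule bij_betw_inv_into) (simp add: bij_betw_def e)
  have "small TYPE('u) (e ` J)"
    using small_lepoll[OF assms(2) image_lepoll] .
  moreover have "is_coproduct C (e ` J) (X \<circ> e') P (\<iota> \<circ> e')"
    by (rule is_coproduct_reindex[OF assms(3) bij]) auto
  moreover have "\<forall>i \<in> e ` J. \<forall>y \<in> Hom C G ((X \<circ> e') i). h \<cdot> (\<iota> \<circ> e') i \<cdot> y = zero_arr C G Z"
    using assms(5) e' by simp
  ultimately show ?thesis
    using assms(1,4,6) unfolding weakly_compact_def by blast
qed

text \<open>A map out of a coproduct is determined by its restrictions to the summands, and these
  vanish by orthogonality.\<close>

lemma left_perp_coproduct:
  assumes "is_coproduct C I W P \<iota>" "\<And>i. i \<in> I \<Longrightarrow> W i \<in> left_perp C \<B>" "\<B> \<subseteq> obj C"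
  shows "P \<in> left_perp C \<B>"
proof -
  have P: "P \<in> obj C" using assms(1) by (simp add: is_coproduct_def)
  have "f = zero_arr C P B" if B: "B \<in> \<B>" and f: "f \<in> Hom C P B" for f B
  proof (rule coproduct_map_ext[OF assms(1) f zero_Hom])
    show "P \<in> obj C" "B \<in> obj C" using P B assms(3) by auto
    fix i assume i: "i \<in> I"
    have "f \<cdot> \<iota> i = zero_arr C (W i) B"
      using assms(2)[OF i] B cmp_Hom[OF coproduct_inj[OF assms(1) i] f]
      unfolding left_perp_def by blast
    then show "f \<cdot> \<iota> i = zero_arr C P B \<cdot> \<iota> i"
      using cmp_zero_left[OF coproduct_inj[OF assms(1) i]] B assms(3) by auto
  qed
  then show ?thesis
    using P assms(3) Hom_zero_iff unfolding left_perp_def by blast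
qed

end

text \<open>\<open>F\<close> may contain arrows with different sources, so that covers of several
  families can be merged into a cover of their union. With \<open>\<W>\<close> the left orthogonal
  of \<B>, this is what the approximation step requires of W -> X.\<close>

definition covered_by :: "('o, 'm, 'z) precat_scheme \<Rightarrow> 'o set \<Rightarrow> 'o \<Rightarrow> 'm set \<Rightarrow> bool" where
  "covered_by C \<W> X F \<longleftrightarrow>
     (\<exists>W\<in>\<W>. \<exists>w \<in> Hom C W X. \<forall>f\<in>F. \<exists>v \<in> Hom C (src C f) W. f = cmp C w v)"

context additive_cat
begin

lemma covered_by_single:
  assumes "f \<in> Hom C W X" "W \<in> \<W>"
  shows "covered_by C \<W> X {f}"
proof -
  have "src C f = W" using assms by (simp add: Hom_def)
  then show ?thesis unfolding covered_by_def
    using assms cmp_ide_right[OF assms(1), symmetric] ide_Hom[OF Hom_obj(1)[OF assms(1)]]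
    by (intro bexI[of _ W] bexI[of _ f] ballI bexI[of _ "ide C W"]) auto
qed

text \<open>The covering objects are replaced by their coproduct, and each arrow factors through the
  summand that covers its own family. Repeated use gives nested coproducts instead of a single one
  over all arrows.\<close>

lemma covered_by_UN:
  assumes "has_small_coproducts TYPE('u) C" "small TYPE('u) J" "X \<in> obj C" "\<B> \<subseteq> obj C"
    and "\<And>j. j \<in> J \<Longrightarrow> covered_by C (left_perp C \<B>) X (F j)"
  shows "covered_by C (left_perp C \<B>) X (\<Union>j\<in>J. F j)"
proof -
  have "\<forall>j\<in>J. \<exists>W w. W \<in> left_perp C \<B> \<and> w \<in> Hom C W X \<and>
      (\<forall>f \<in> F j. \<exists>v \<in> Hom C (src C f) W. f = w \<cdot> v)"
    using assms(5) unfolding covered_by_def by blast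
  then obtain W w where Ww: "\<And>j. j \<in> J \<Longrightarrow> W j \<in> left_perp C \<B>" "\<And>j. j \<in> J \<Longrightarrow> w j \<in> Hom C (W j) X"
      "\<And>j f. j \<in> J \<Longrightarrow> f \<in> F j \<Longrightarrow> \<exists>v \<in> Hom C (src C f) (W j). f = w j \<cdot> v"
    by metis
  have "\<And>j. j \<in> J \<Longrightarrow> W j \<in> obj C" using Ww(1) by (simp add: left_perp_def)
  from small_coproduct[OF assms(1,2), where X = W, OF this]
  obtain P \<iota> where P: "is_coproduct C J W P \<iota>" by blast
  obtain p where p: "p \<in> Hom C P X" "\<And>j. j \<in> J \<Longrightarrow> p \<cdot> \<iota> j = w j"
    using coproduct_map[OF P assms(3) Ww(2)] by blast
  have "\<exists>v \<in> Hom C (src C f) P. f = p \<cdot> v" if j: "j \<in> J" and f: "f \<in> F j" for j f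
  proof -
    obtain v where v: "v \<in> Hom C (src C f) (W j)" "f = w j \<cdot> v" using Ww(3)[OF j f] by blast
    have "\<iota> j \<cdot> v \<in> Hom C (src C f) P" using cmp_Hom[OF v(1) coproduct_inj[OF P j]] .
    moreover have "f = p \<cdot> \<iota> j \<cdot> v"
      using cmp_assoc[OF v(1) coproduct_inj[OF P j] p(1)] p(2)[OF j] v(2) by simp
    ultimately show ?thesis by blast
  qed
  moreover have "P \<in> left_perp C \<B>" using left_perp_coproduct[OF P Ww(1) assms(4)] .
  ultimately show ?thesis unfolding covered_by_def using p(1) by blast
qed

end

section \<open>Exactness of Hom functors\<close>

context triangulated_cat
begin

lemma susp_obj: "X \<in> obj T \<Longrightarrow> susp T X \<in> obj T"
  using susp_bij by (auto simp: bij_betw_def)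

lemma desusp_obj: "X \<in> obj T \<Longrightarrow> desusp T X \<in> obj T"
  using susp_bij unfolding desusp_def by (auto simp: bij_betw_def inv_into_into)

lemma susp_desusp: "X \<in> obj T \<Longrightarrow> susp T (desusp T X) = X"
  using susp_bij unfolding desusp_def by (auto simp: bij_betw_def f_inv_into_f)

lemma desusp_susp: "X \<in> obj T \<Longrightarrow> desusp T (susp T X) = X"
  using susp_bij unfolding desusp_def by (auto simp: bij_betw_def)

lemma susp_arr_inj:
  assumes "f \<in> Hom T X Y" "g \<in> Hom T X' Y'" "susp_arr T f = susp_arr T g"
  shows "f = g"
  using susp_arr_bij assms by (auto simp: bij_betw_def inj_on_def Hom_def)

text \<open>A preimage exists by bijectivity on arrows, with source and target at first unknown;
  they are identified by injectivity of the suspension on objects. Together with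
  \<open>susp_arr_inj\<close> this makes the suspension fully faithful.\<close>

lemma susp_arr_surj:
  assumes "k \<in> Hom T (susp T X) (susp T Y)" "X \<in> obj T" "Y \<in> obj T"
  obtains f where "f \<in> Hom T X Y" "susp_arr T f = k"
proof -
  have "k \<in> arr T" using assms by (simp add: Hom_def)
  then have "k \<in> susp_arr T ` arr T" using bij_betw_imp_surj_on[OF susp_arr_bij] by simp
  then obtain f where f: "f \<in> arr T" "susp_arr T f = k" by blast
  have f': "f \<in> Hom T (src T f) (tgt T f)" using f by (simp add: Hom_def)
  then have "k \<in> Hom T (susp T (src T f)) (susp T (tgt T f))" using susp_arr_Hom f(2) by blast
  then have "susp T (src T f) = susp T X" "susp T (tgt T f) = susp T Y"
    using assms(1) by (auto simp: Hom_def)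
  then have "src T f = X" "tgt T f = Y" using desusp_susp Hom_obj[OF f'] assms by metis+
  then show thesis using that f f' by blast
qed

lemma susp_arr_zero:
  assumes "X \<in> obj T" "Y \<in> obj T"
  shows "susp_arr T (zero_arr T X Y) = zero_arr T (susp T X) (susp T Y)"
proof (rule idem_zero)
  have z: "zero_arr T X Y \<in> Hom T X Y" using assms by (rule zero_Hom)
  show "susp_arr T (zero_arr T X Y) \<in> Hom T (susp T X) (susp T Y)" using susp_arr_Hom[OF z] .
  show "add_arr T (susp_arr T (zero_arr T X Y)) (susp_arr T (zero_arr T X Y))
      = susp_arr T (zero_arr T X Y)"
    using susp_arr_add[OF z z] add_zero_left[OF z] by simp
qed

lemma susp_arr_eq_zero:
  assumes "f \<in> Hom T X Y" "susp_arr T f = zero_arr T (susp T X) (susp T Y)"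
  shows "f = zero_arr T X Y"
  using assms susp_arr_zero susp_arr_inj zero_Hom Hom_obj by metis

lemma susp_Hom_zero_iff:
  assumes "X \<in> obj T" "Y \<in> obj T"
  shows "Hom T (susp T X) (susp T Y) = {zero_arr T (susp T X) (susp T Y)}
    \<longleftrightarrow> Hom T X Y = {zero_arr T X Y}"
  unfolding Hom_zero_iff[OF assms] Hom_zero_iff[OF susp_obj[OF assms(1)] susp_obj[OF assms(2)]]
proof
  assume L: "\<forall>f\<in>Hom T (susp T X) (susp T Y). f = zero_arr T (susp T X) (susp T Y)"
  show "\<forall>f\<in>Hom T X Y. f = zero_arr T X Y"
    using L susp_arr_Hom susp_arr_eq_zero by blast
next
  assume R: "\<forall>f\<in>Hom T X Y. f = zero_arr T X Y"
  show "\<forall>f\<in>Hom T (susp T X) (susp T Y). f = zero_arr T (susp T X) (susp T Y)"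
    using R susp_arr_surj[OF _ assms] susp_arr_zero[OF assms] by metis
qed

lemma dist_triangleD:
  assumes "dist_triangle T X Y Z f g h"
  shows "X \<in> obj T" "Y \<in> obj T" "Z \<in> obj T" "f \<in> Hom T X Y" "g \<in> Hom T Y Z"
    "h \<in> Hom T Z (susp T X)"
  using assms by (auto simp: dist_triangle_def is_triangle_def)

lemma dist_rotateI:
  assumes "dist_triangle T X Y Z f g h"
  shows "dist_triangle T Y Z (susp T X) g h (neg_arr T (susp_arr T f))"
  using assms dist_rotate[of X Y Z f g h] by (simp add: dist_triangle_def)

text \<open>The pair of the identity and \<open>f\<close> maps the triangle X = X -> 0 to the given
  one, so the composite factors through a zero object.\<close>

lemma dist_cmp_zero:
  assumes "dist_triangle T X Y Z f g h"
  shows "g \<cdot> f = zero_arr T X Z"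
proof -
  note D = dist_triangleD[OF assms]
  obtain N where N: "zero_object T N" using ex_zero_object by blast
  obtain c where c: "c \<in> Hom T N Z" "c \<cdot> zero_arr T X N = g \<cdot> f"
    using dist_fill[OF dist_ide[OF D(1) N] assms ide_Hom[OF D(1)] D(4)] by blast
  then show ?thesis using cmp_zero_right[OF c(1) D(1)] by simp
qed

lemma dist_cmp_zero3:
  assumes "dist_triangle T X Y Z f g h"
  shows "susp_arr T f \<cdot> h = zero_arr T Z (susp T Y)"
proof -
  note D = dist_triangleD[OF assms]
  have S: "susp_arr T f \<in> Hom T (susp T X) (susp T Y)" using susp_arr_Hom[OF D(4)] .
  have "neg_arr T (susp_arr T f \<cdot> h) = zero_arr T Z (susp T Y)"
    using dist_cmp_zero[OF dist_rotateI[OF dist_rotateI[OF assms]]] neg_cmp_left[OF D(6) S] by simp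
  then show ?thesis
    using neg_neg[OF cmp_Hom[OF D(6) S]] neg_zero D susp_obj by metis
qed

text \<open>The zero map X -> M and \<open>u\<close> form a commutative square into the triangle M
  -> W = W -> N, where \<open>N\<close> is zero and \<open>M\<close> its desuspension; the
  completing arrow is \<open>v\<close>.\<close>

lemma dist_weak_cokernel:
  assumes "dist_triangle T X Y Z f g h" "u \<in> Hom T Y W" "u \<cdot> f = zero_arr T X W"
  obtains v where "v \<in> Hom T Z W" "u = v \<cdot> g"
proof -
  note D = dist_triangleD[OF assms(1)]
  have W: "W \<in> obj T" using Hom_obj assms(2) by blast
  obtain N where N: "zero_object T N" using ex_zero_object by blast
  define M where "M = desusp T N"
  have N': "N \<in> obj T" using N by (simp add: zero_object_def)
  have M: "M \<in> obj T" "susp T M = N" using desusp_obj[OF N'] susp_desusp[OF N'] by (auto simp: M_def)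
  \<comment> \<open>The target triangle is the identity triangle of \<open>W\<close> rotated
    backwards, which requires \<open>N\<close> to be literally the suspension of
    \<open>M\<close>.\<close>
  have "neg_arr T (susp_arr T (zero_arr T M W)) = zero_arr T N (susp T W)"
    using susp_arr_zero[OF M(1) W] M neg_zero N' susp_obj[OF W] by simp
  moreover have tri: "is_triangle T M W W (zero_arr T M W) (ide T W) (zero_arr T W N)"
    using M W N' zero_Hom ide_Hom by (simp add: is_triangle_def)
  ultimately have tri': "dist_triangle T M W W (zero_arr T M W) (ide T W) (zero_arr T W N)"
    using dist_rotate[OF tri] dist_ide[OF W N] M(2) by simp
  have "u \<cdot> f = zero_arr T M W \<cdot> zero_arr T X M"
    using assms(3) cmp_zero_left[OF zero_Hom[OF D(1) M(1)] W] by simp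
  then obtain c where c: "c \<in> Hom T Z W" "c \<cdot> g = ide T W \<cdot> u"
    using dist_fill[OF assms(1) tri' zero_Hom[OF D(1) M(1)] assms(2)] by blast
  then show thesis using that cmp_ide_left[OF assms(2)] by simp
qed

text \<open>Here \<open>u\<close> and the zero map N -> Z form a square from W -> 0 -> \<Sigma>W to
  Y -> Z -> \<Sigma>X, both obtained by rotation. The completing arrow \<Sigma>W -> \<Sigma>X
  desuspends to \<open>v\<close>, and the signs from the two rotations cancel.\<close>

lemma dist_weak_kernel:
  assumes "dist_triangle T X Y Z f g h" "u \<in> Hom T W Y" "g \<cdot> u = zero_arr T W Z"
  obtains v where "v \<in> Hom T W X" "u = f \<cdot> v"
proof -
  note D = dist_triangleD[OF assms(1)]
  have W: "W \<in> obj T" using Hom_obj assms(2) by blast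
  obtain N where N: "zero_object T N" using ex_zero_object by blast
  have N': "N \<in> obj T" using N by (simp add: zero_object_def)
  have S: "susp_arr T f \<in> Hom T (susp T X) (susp T Y)" "susp_arr T u \<in> Hom T (susp T W) (susp T Y)"
    using susp_arr_Hom D(4) assms(2) by auto
  have id: "ide T (susp T W) \<in> Hom T (susp T W) (susp T W)" using ide_Hom susp_obj W by blast
  have "zero_arr T N Z \<cdot> zero_arr T W N = g \<cdot> u"
    using assms(3) cmp_zero_left[OF zero_Hom[OF W N'] D(3)] by simp
  then obtain c where c: "c \<in> Hom T (susp T W) (susp T X)"
      "susp_arr T u \<cdot> neg_arr T (susp_arr T (ide T W)) = neg_arr T (susp_arr T f) \<cdot> c"
    using dist_fill[OF dist_rotateI[OF dist_ide[OF W N]] dist_rotateI[OF assms(1)] assms(2)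
        zero_Hom[OF N' D(3)]] by blast
  obtain v where v: "v \<in> Hom T W X" "susp_arr T v = c" using susp_arr_surj[OF c(1) W D(1)] .
  have "neg_arr T (susp_arr T u) = neg_arr T (susp_arr T f \<cdot> c)"
    using c(2) neg_cmp_left[OF c(1) S(1)] neg_cmp_right[OF id S(2)] cmp_ide_right[OF S(2)]
      susp_arr_ide[OF W] by simp
  then have "susp_arr T u = susp_arr T f \<cdot> susp_arr T v"
    unfolding v(2) by (rule neg_inj[OF S(2) cmp_Hom[OF c(1) S(1)]])
  then have "susp_arr T u = susp_arr T (f \<cdot> v)" using susp_arr_cmp[OF v(1) D(4)] by simp
  then have "u = f \<cdot> v" using susp_arr_inj[OF assms(2) cmp_Hom[OF v(1) D(4)]] by blast
  then show thesis using that v by blast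
qed

text \<open>The suspension is an automorphism: a cocone under the suspended family desuspends to one
  under the original family, and its induced map is suspended again.\<close>

lemma susp_coproduct:
  assumes "is_coproduct T I X P \<iota>"
  shows "is_coproduct T I (\<lambda>i. susp T (X i)) (susp T P) (\<lambda>i. susp_arr T (\<iota> i))"
  unfolding is_coproduct_def
proof (intro conjI ballI allI impI)
  have P: "P \<in> obj T" using assms by (simp add: is_coproduct_def)
  show "susp T P \<in> obj T" using susp_obj[OF P] .
  show "susp_arr T (\<iota> i) \<in> Hom T (susp T (X i)) (susp T P)" if "i \<in> I" for i
    using susp_arr_Hom[OF coproduct_inj[OF assms that]] .
  fix Y f assume Y: "Y \<in> obj T" and f: "\<forall>i\<in>I. f i \<in> Hom T (susp T (X i)) Y"
  define Y' where "Y' = desusp T Y"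
  have Y': "Y' \<in> obj T" "susp T Y' = Y" using Y desusp_obj susp_desusp by (auto simp: Y'_def)
  have "\<forall>i\<in>I. \<exists>f'. f' \<in> Hom T (X i) Y' \<and> susp_arr T f' = f i"
    using susp_arr_surj f Y' Hom_obj(1) coproduct_inj[OF assms] by metis
  then obtain f' where f': "\<And>i. i \<in> I \<Longrightarrow> f' i \<in> Hom T (X i) Y'" "\<And>i. i \<in> I \<Longrightarrow> susp_arr T (f' i) = f i"
    by metis
  obtain h where h: "h \<in> Hom T P Y'" "\<And>i. i \<in> I \<Longrightarrow> h \<cdot> \<iota> i = f' i"
    using coproduct_map[OF assms Y'(1) f'(1)] by blast
  show "\<exists>!h. h \<in> Hom T (susp T P) Y \<and> (\<forall>i\<in>I. h \<cdot> susp_arr T (\<iota> i) = f i)"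
  proof (rule ex1I[of _ "susp_arr T h"])
    show "susp_arr T h \<in> Hom T (susp T P) Y \<and> (\<forall>i\<in>I. susp_arr T h \<cdot> susp_arr T (\<iota> i) = f i)"
      using susp_arr_Hom[OF h(1)] Y'(2) h f' susp_arr_cmp[OF coproduct_inj[OF assms] h(1)] by metis
    fix k assume k: "k \<in> Hom T (susp T P) Y \<and> (\<forall>i\<in>I. k \<cdot> susp_arr T (\<iota> i) = f i)"
    then obtain k' where k': "k' \<in> Hom T P Y'" "susp_arr T k' = k"
      using susp_arr_surj P Y' by metis
    have "k' = h"
    proof (rule coproduct_map_ext[OF assms k'(1) h(1)])
      fix i assume i: "i \<in> I"
      have "susp_arr T (k' \<cdot> \<iota> i) = susp_arr T (f' i)"
        using susp_arr_cmp[OF coproduct_inj[OF assms i] k'(1)] k'(2) k f'(2) i by simp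
      then show "k' \<cdot> \<iota> i = h \<cdot> \<iota> i"
        using susp_arr_inj[OF cmp_Hom[OF coproduct_inj[OF assms i] k'(1)] f'(1)[OF i]] h(2)[OF i]
        by simp
    qed
    then show "k = susp_arr T h" using k' by simp
  qed
qed

text \<open>Maps from \<open>desusp T G\<close> to X correspond to maps from \<open>G\<close> to
  \<Sigma>X, and \<Sigma> preserves coproducts.\<close>

lemma weakly_compact_desusp:
  assumes "weakly_compact TYPE('u) T G"
  shows "weakly_compact TYPE('u) T (desusp T G)"
  unfolding weakly_compact_def
proof (intro conjI allI impI ballI)
  have G: "G \<in> obj T" using assms by (simp add: weakly_compact_def)
  define G' where "G' = desusp T G"
  have G': "G' \<in> obj T" "susp T G' = G" using G desusp_obj susp_desusp by (auto simp: G'_def)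
  then show "desusp T G \<in> obj T" by (simp add: G'_def)
  fix I :: "'u set" and X P \<iota> Z h x
  assume I: "small TYPE('u) I" and P: "is_coproduct T I X P \<iota>" and h: "h \<in> Hom T P Z"
    and zero: "\<forall>i\<in>I. \<forall>y \<in> Hom T (desusp T G) (X i). h \<cdot> \<iota> i \<cdot> y = zero_arr T (desusp T G) Z"
    and x: "x \<in> Hom T (desusp T G) P"
  note zero = zero[folded G'_def] and x = x[folded G'_def]
  have "susp_arr T h \<cdot> susp_arr T x = zero_arr T G (susp T Z)"
  proof (rule weakly_compactD[OF assms I susp_coproduct[OF P] susp_arr_Hom[OF h]])
    show "susp_arr T x \<in> Hom T G (susp T P)" using susp_arr_Hom[OF x] G' by simp
    fix i y assume i: "i \<in> I" and y: "y \<in> Hom T G (susp T (X i))"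
    have \<iota>: "\<iota> i \<in> Hom T (X i) P" using coproduct_inj[OF P i] .
    obtain y' where y': "y' \<in> Hom T G' (X i)" "susp_arr T y' = y"
      using susp_arr_surj[of y G' "X i"] y G' Hom_obj(1)[OF \<iota>] by metis
    have "susp_arr T h \<cdot> susp_arr T (\<iota> i) \<cdot> y = susp_arr T (h \<cdot> \<iota> i \<cdot> y')"
      using susp_arr_cmp[OF y'(1) \<iota>] susp_arr_cmp[OF cmp_Hom[OF y'(1) \<iota>] h] y'(2) by simp
    also have "\<dots> = susp_arr T (zero_arr T G' Z)" using zero i y'(1) by simp
    also have "\<dots> = zero_arr T G (susp T Z)"
      using susp_arr_zero[OF G'(1) Hom_obj(2)[OF h]] G'(2) by simp
    finally show "susp_arr T h \<cdot> susp_arr T (\<iota> i) \<cdot> y = zero_arr T G (susp T Z)" .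
  qed
  then have "h \<cdot> x = zero_arr T G' Z"
    using susp_arr_eq_zero[OF cmp_Hom[OF x h]] susp_arr_cmp[OF x h] G'(2) by simp
  then show "h \<cdot> x = zero_arr T (desusp T G) Z" by (simp add: G'_def)
qed

end

section \<open>The approximation sequence and its homotopy colimit\<close>

text \<open>
  For a map \<open>f: X \<rightarrow> X'\<close> with cone \<open>Z\<close>, this is the condition that makes \<open>Hom(Z, \<Sigma>Y)\<close> vanish for
  all \<open>Y \<in> \<B>\<close>.
\<close>

definition coconic :: "('o, 'm, 'z) pretri_cat_scheme \<Rightarrow> 'o set \<Rightarrow> 'o \<Rightarrow> 'o \<Rightarrow> 'm \<Rightarrow> bool" where
  "coconic T \<B> X X' f \<longleftrightarrow> f \<in> Hom T X X' \<and>
     (\<forall>Y\<in>\<B>. \<forall>u \<in> Hom T X Y. \<exists>v \<in> Hom T X' Y. u = cmp T v f) \<and>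
     (\<forall>Y\<in>\<B>. \<forall>u \<in> Hom T X' (susp T Y). cmp T u f = zero_arr T X (susp T Y) \<longrightarrow>
        u = zero_arr T X' (susp T Y))"

context triangulated_cat
begin

lemma coconicD:
  assumes "coconic T \<B> X X' f"
  shows "f \<in> Hom T X X'"
    "\<lbrakk>Y \<in> \<B>; u \<in> Hom T X Y\<rbrakk> \<Longrightarrow> \<exists>v \<in> Hom T X' Y. u = v \<cdot> f"
    "\<lbrakk>Y \<in> \<B>; u' \<in> Hom T X' (susp T Y); u' \<cdot> f = zero_arr T X (susp T Y)\<rbrakk>
      \<Longrightarrow> u' = zero_arr T X' (susp T Y)"
  using assms unfolding coconic_def by auto

text \<open>Let \<open>Z\<close> be the cone of \<open>g\<close> and u: Z -> \<Sigma>Y with Y in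
  \<B>. The vanishing condition kills \<open>u \<cdot> h\<close>, so u factors through
  \<open>k\<close>. The factor is the suspension of a map X -> Y, which extends over
  \<open>g\<close>; so u factors through the zero map \<open>susp_arr T g \<cdot> k\<close>.\<close>

lemma coconic_cocone:
  assumes "coconic T \<B> X B g" "\<B> \<subseteq> obj T"
  shows "\<exists>C \<in> left_perp T \<B>. \<exists>f h. dist_triangle T C X B f g h"
proof -
  note A = coconicD[OF assms(1)]
  obtain Z h k where Z: "dist_triangle T X B Z g h k"
    using dist_complete[OF A(1)] by blast
  note D = dist_triangleD[OF Z]
  define C where "C = desusp T Z"
  have C: "C \<in> obj T" "susp T C = Z" using D desusp_obj susp_desusp by (auto simp: C_def)
  \<comment> \<open>The sign is chosen so that rotating C -> X -> B, which introduces another sign,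
    returns exactly \<open>k\<close>.\<close>
  have "neg_arr T k \<in> Hom T (susp T C) (susp T X)" using neg_Hom(1)[OF D(6)] C(2) by simp
  then obtain f where f: "f \<in> Hom T C X" "susp_arr T f = neg_arr T k"
    using susp_arr_surj[OF _ C(1) D(1)] by blast
  have "is_triangle T C X B f g h"
    using C D f by (simp add: is_triangle_def)
  then have "dist_triangle T C X B f g h"
    using dist_rotate[of C X B f g h] Z C(2) f(2) neg_neg[OF D(6)] by simp
  moreover have "C \<in> left_perp T \<B>"
  proof -
    have "u = zero_arr T Z (susp T Y)" if Y: "Y \<in> \<B>" and u: "u \<in> Hom T Z (susp T Y)" for Y u
    proof -
      have YT: "Y \<in> obj T" "susp T Y \<in> obj T" using Y assms(2) susp_obj by auto
      have "(u \<cdot> h) \<cdot> g = u \<cdot> (h \<cdot> g)" using cmp_assoc[OF D(4,5) u] .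
      also have "\<dots> = zero_arr T X (susp T Y)"
        using dist_cmp_zero[OF Z] cmp_zero_right[OF u D(1)] by simp
      finally have "u \<cdot> h = zero_arr T B (susp T Y)"
        using A(3)[OF Y cmp_Hom[OF D(5) u]] by blast
      then obtain v where v: "v \<in> Hom T (susp T X) (susp T Y)" "u = v \<cdot> k"
        using dist_weak_cokernel[OF dist_rotateI[OF Z] u] by blast
      obtain v' where v': "v' \<in> Hom T X Y" "susp_arr T v' = v"
        using susp_arr_surj[OF v(1) D(1) YT(1)] by blast
      obtain e where e: "e \<in> Hom T B Y" "v' = e \<cdot> g" using A(2)[OF Y v'(1)] by blast
      have "u = (susp_arr T e \<cdot> susp_arr T g) \<cdot> k"
        using v(2) v'(2) e(2) susp_arr_cmp[OF D(4) e(1)] by simp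
      also have "\<dots> = susp_arr T e \<cdot> (susp_arr T g \<cdot> k)"
        using cmp_assoc[OF D(6) susp_arr_Hom[OF D(4)] susp_arr_Hom[OF e(1)]] .
      also have "\<dots> = zero_arr T Z (susp T Y)"
        using dist_cmp_zero3[OF Z] cmp_zero_right[OF susp_arr_Hom[OF e(1)] D(3)] by simp
      finally show ?thesis .
    qed
    then have "Hom T C Y = {zero_arr T C Y}" if "Y \<in> \<B>" for Y
      using that susp_Hom_zero_iff[of C Y] Hom_zero_iff[of Z "susp T Y"] C D(3) assms(2) susp_obj
      by (metis subsetD)
    then show ?thesis using C(1) by (simp add: left_perp_def)
  qed
  ultimately show ?thesis by blast
qed

text \<open>\<open>X'\<close> is the cone of the covering map \<open>w\<close>. Both conditions on
  \<open>f\<close> follow from orthogonality of \<open>W\<close> to \<B>: the obstruction to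
  extending u is \<open>u \<cdot> w\<close>, and a map killed by \<open>f\<close> factors through
  \<Sigma>W. Maps from members of \<open>\<G>\<close> factor through \<open>w\<close> and so die
  under \<open>f\<close>.\<close>

lemma coconic_step:
  assumes "covered_by T (left_perp T \<B>) X (\<Union>G\<in>\<G>. Hom T G X)" "\<B> \<subseteq> obj T"
  shows "\<exists>X' f. coconic T \<B> X X' f \<and> (\<forall>G\<in>\<G>. \<forall>y \<in> Hom T G X. f \<cdot> y = zero_arr T G X')"
proof -
  obtain W w where W: "W \<in> left_perp T \<B>" and w: "w \<in> Hom T W X"
    and cov: "\<And>y. y \<in> (\<Union>G\<in>\<G>. Hom T G X) \<Longrightarrow> \<exists>v \<in> Hom T (src T y) W. y = w \<cdot> v"
    using assms(1) unfolding covered_by_def by blast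
  obtain X' f h where tri: "dist_triangle T W X X' w f h" using dist_complete[OF w] by blast
  note D = dist_triangleD[OF tri]
  have perp: "u = zero_arr T W Y" if "Y \<in> \<B>" "u \<in> Hom T W Y" for Y u
    using W that unfolding left_perp_def by blast
  have "coconic T \<B> X X' f"
    unfolding coconic_def
  proof (intro conjI ballI impI)
    show "f \<in> Hom T X X'" using D(5) .
  next
    fix Y u assume Y: "Y \<in> \<B>" and u: "u \<in> Hom T X Y"
    show "\<exists>v \<in> Hom T X' Y. u = v \<cdot> f"
      using dist_weak_cokernel[OF tri u perp[OF Y cmp_Hom[OF w u]]] by blast
  next
    fix Y u assume Y: "Y \<in> \<B>" and u: "u \<in> Hom T X' (susp T Y)"
      and uf: "u \<cdot> f = zero_arr T X (susp T Y)"
    have YT: "Y \<in> obj T" using Y assms(2) by blast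
    obtain v where v: "v \<in> Hom T (susp T W) (susp T Y)" "u = v \<cdot> h"
      using dist_weak_cokernel[OF dist_rotateI[OF tri] u uf] by blast
    obtain v' where v': "v' \<in> Hom T W Y" "susp_arr T v' = v"
      using susp_arr_surj[OF v(1) D(1) YT] by blast
    have "v = zero_arr T (susp T W) (susp T Y)"
      using perp[OF Y v'(1)] v'(2) susp_arr_zero[OF D(1) YT] by simp
    then show "u = zero_arr T X' (susp T Y)"
      using v(2) cmp_zero_left[OF D(6) susp_obj[OF YT]] by simp
  qed
  moreover have "f \<cdot> y = zero_arr T G X'" if "G \<in> \<G>" and y: "y \<in> Hom T G X" for G y
  proof -
    have "src T y = G" using y by (simp add: Hom_def)
    moreover have "y \<in> (\<Union>G\<in>\<G>. Hom T G X)" using that by (rule UN_I)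
    ultimately obtain v where v: "v \<in> Hom T G W" "y = w \<cdot> v" using cov[of y] by auto
    have "f \<cdot> y = (f \<cdot> w) \<cdot> v" using cmp_assoc[OF v(1) w D(5)] v(2) by simp
    then show ?thesis using dist_cmp_zero[OF tri] cmp_zero_left[OF v(1) D(3)] by simp
  qed
  ultimately show ?thesis by blast
qed

text \<open>
  The homotopy colimit of the sequence \<open>X 0 \<rightarrow> X 1 \<rightarrow> \<dots>\<close> is the cone of \<open>id - s\<close> on the coproduct,
  where \<open>s\<close> is induced by the maps \<open>f i\<close>.  The map \<open>s\<close> kills every map from a member of \<open>\<G>\<close>, whence
  \<open>id - s\<close> acts as the identity on such maps.
\<close>

lemma coconic_hocolim:
  fixes X :: "nat \<Rightarrow> 'o"
  assumes "has_small_coproducts TYPE('u) T" "small TYPE('u) (UNIV :: nat set)" "\<B> \<subseteq> obj T"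
    and step: "\<And>i. coconic T \<B> (X i) (X (Suc i)) (f i)"
    and kill: "\<And>i G y. \<lbrakk>G \<in> \<G>; y \<in> Hom T G (X i)\<rbrakk> \<Longrightarrow> f i \<cdot> y = zero_arr T G (X (Suc i))"
    and \<G>: "\<And>G. G \<in> \<G> \<Longrightarrow> weakly_compact TYPE('u) T G" "\<And>G. G \<in> \<G> \<Longrightarrow> desusp T G \<in> \<G>"
  shows "\<exists>B g. coconic T \<B> (X 0) B g \<and> (\<forall>G\<in>\<G>. Hom T G B = {zero_arr T G B})"
proof -
  have f: "f i \<in> Hom T (X i) (X (Suc i))" for i using coconicD(1)[OF step] .
  have X: "X i \<in> obj T" for i using Hom_obj(1)[OF f] .
  obtain P \<iota> where P: "is_coproduct T (UNIV :: nat set) X P \<iota>"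
    using small_coproduct[OF assms(1,2), of X] X by blast
  have PT: "P \<in> obj T" using P by (simp add: is_coproduct_def)
  have \<iota>: "\<iota> i \<in> Hom T (X i) P" for i using coproduct_inj[OF P] by simp
  have \<iota>f: "\<iota> (Suc i) \<cdot> f i \<in> Hom T (X i) P" for i using cmp_Hom[OF f \<iota>] .
  obtain s where s: "s \<in> Hom T P P" and s\<iota>: "\<And>i. s \<cdot> \<iota> i = \<iota> (Suc i) \<cdot> f i"
    using coproduct_map[OF P PT, of "\<lambda>i. \<iota> (Suc i) \<cdot> f i"] \<iota>f by auto
  \<comment> \<open>\<open>d\<close> plays the role of \<open>id - s\<close>.\<close>
  obtain d where d: "d \<in> Hom T P P" and ds: "add_arr T d s = ide T P"
    using ex_diff[OF ide_Hom[OF PT] s] .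
  have split: "x = add_arr T (x \<cdot> d) (x \<cdot> s)" if "x \<in> Hom T P Z" for x Z
    using cmp_add_right[OF d s that] ds cmp_ide_right[OF that] by simp
  have split': "x = add_arr T (d \<cdot> x) (s \<cdot> x)" if "x \<in> Hom T Z P" for x Z
    using cmp_add_left[OF that d s] ds cmp_ide_left[OF that] by simp
  have skill: "s \<cdot> x = zero_arr T G P" if G: "G \<in> \<G>" and x: "x \<in> Hom T G P" for G x
  proof (rule weakly_compactD[OF \<G>(1)[OF G] assms(2) P s _ x])
    fix i y assume y: "y \<in> Hom T G (X i)"
    have "s \<cdot> \<iota> i \<cdot> y = \<iota> (Suc i) \<cdot> f i \<cdot> y"
      using cmp_assoc[OF y \<iota> s] cmp_assoc[OF y f \<iota>] s\<iota> by simp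
    then show "s \<cdot> \<iota> i \<cdot> y = zero_arr T G P"
      using kill[OF G y] cmp_zero_right[OF \<iota> Hom_obj(1)[OF y]] by simp
  qed
  obtain B q w where tri: "dist_triangle T P P B d q w" using dist_complete[OF d] by blast
  note D = dist_triangleD[OF tri]
  have qs: "q \<cdot> s = q"
    using split[OF D(5)] dist_cmp_zero[OF tri] add_zero_left[OF cmp_Hom[OF s D(5)]] by simp
  \<comment> \<open>Every \<open>k\<close> has the form \<open>e \<cdot> d\<close> with
    \<open>e \<cdot> \<iota> 0\<close> prescribed: on components the equation reads e_i = k_i +
    e_(i+1) f_i, and e_(i+1) is found by extending e_i - k_i along \<open>f i\<close>.\<close>
  have solve: "\<exists>e \<in> Hom T P Y. e \<cdot> \<iota> 0 = v \<and> e \<cdot> d = k"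
    if Y: "Y \<in> \<B>" and v: "v \<in> Hom T (X 0) Y" and k: "k \<in> Hom T P Y" for Y v k
  proof -
    have YT: "Y \<in> obj T" using Y assms(3) by blast
    have k\<iota>: "k \<cdot> \<iota> i \<in> Hom T (X i) Y" for i using cmp_Hom[OF \<iota> k] .
    have "\<exists>e. e 0 = v \<and> (\<forall>i. e i \<in> Hom T (X i) Y \<and> add_arr T (k \<cdot> \<iota> i) (e (Suc i) \<cdot> f i) = e i)"
    proof -
      \<comment> \<open>The clause for \<open>i = 0\<close> pins down the first term, which
        \<open>dependent_nat_choice\<close> by itself leaves open.\<close>
      have "\<exists>e. \<forall>i. (e i \<in> Hom T (X i) Y \<and> (i = 0 \<longrightarrow> e i = v)) \<and>
          add_arr T (k \<cdot> \<iota> i) (e (Suc i) \<cdot> f i) = e i"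
      proof (rule dependent_nat_choice)
        show "\<exists>e. e \<in> Hom T (X 0) Y \<and> (0 = (0::nat) \<longrightarrow> e = v)" using v by blast
        fix e i assume e: "e \<in> Hom T (X i) Y \<and> (i = 0 \<longrightarrow> e = v)"
        have e: "e \<in> Hom T (X i) Y" using e by blast
        obtain c where c: "c \<in> Hom T (X i) Y" "add_arr T c (k \<cdot> \<iota> i) = e"
          using ex_diff[OF e k\<iota>] .
        obtain e' where e': "e' \<in> Hom T (X (Suc i)) Y" "c = e' \<cdot> f i"
          using coconicD(2)[OF step Y c(1)] by blast
        have "add_arr T (k \<cdot> \<iota> i) (e' \<cdot> f i) = e"
          using add_commute[OF c(1) k\<iota>] c(2) e'(2) by simp
        then show "\<exists>e'. (e' \<in> Hom T (X (Suc i)) Y \<and> (Suc i = 0 \<longrightarrow> e' = v)) \<and>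
            add_arr T (k \<cdot> \<iota> i) (e' \<cdot> f i) = e"
          using e'(1) by blast
      qed
      then show ?thesis by blast
    qed
    then obtain e where e0: "e 0 = v" and eH: "\<And>i. e i \<in> Hom T (X i) Y"
      and eS: "\<And>i. add_arr T (k \<cdot> \<iota> i) (e (Suc i) \<cdot> f i) = e i" by blast
    obtain e' where e': "e' \<in> Hom T P Y" and e'\<iota>: "\<And>i. e' \<cdot> \<iota> i = e i"
      using coproduct_map[OF P YT, of e] eH by auto
    have "e' \<cdot> d = k"
    proof (rule coproduct_map_ext[OF P cmp_Hom[OF d e'] k])
      fix i
      have es: "(e' \<cdot> s) \<cdot> \<iota> i = e (Suc i) \<cdot> f i"
        using cmp_assoc[OF \<iota> s e'] cmp_assoc[OF f \<iota> e'] s\<iota> e'\<iota> by simp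
      have "e i = add_arr T (e' \<cdot> d) (e' \<cdot> s) \<cdot> \<iota> i" using split[OF e'] e'\<iota> by simp
      also have "\<dots> = add_arr T ((e' \<cdot> d) \<cdot> \<iota> i) (e (Suc i) \<cdot> f i)"
        using cmp_add_left[OF \<iota> cmp_Hom[OF d e'] cmp_Hom[OF s e']] es by simp
      finally have "add_arr T ((e' \<cdot> d) \<cdot> \<iota> i) (e (Suc i) \<cdot> f i)
          = add_arr T (k \<cdot> \<iota> i) (e (Suc i) \<cdot> f i)" using eS by simp
      then show "(e' \<cdot> d) \<cdot> \<iota> i = k \<cdot> \<iota> i"
        by (rule add_cancel_right[OF cmp_Hom[OF \<iota> cmp_Hom[OF d e']] k\<iota> cmp_Hom[OF f eH]])
    qed
    then show ?thesis using e' e'\<iota> e0 by blast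
  qed
  define g where "g = q \<cdot> \<iota> 0"
  have g: "g \<in> Hom T (X 0) B" using cmp_Hom[OF \<iota> D(5)] by (simp add: g_def)
  have "coconic T \<B> (X 0) B g"
    unfolding coconic_def
  proof (intro conjI ballI impI)
    show "g \<in> Hom T (X 0) B" using g .
  next
    fix Y u assume Y: "Y \<in> \<B>" and u: "u \<in> Hom T (X 0) Y"
    have YT: "Y \<in> obj T" using Y assms(3) by blast
    \<comment> \<open>With \<open>k\<close> zero, the solution kills \<open>d\<close> and hence
      factors through the cone, while its component at 0 is \<open>u\<close>.\<close>
    obtain e where e: "e \<in> Hom T P Y" "e \<cdot> \<iota> 0 = u" "e \<cdot> d = zero_arr T P Y"
      using solve[OF Y u zero_Hom[OF PT YT]] by blast
    obtain v where v: "v \<in> Hom T B Y" "e = v \<cdot> q" using dist_weak_cokernel[OF tri e(1,3)] by blast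
    have "u = v \<cdot> g" using e(2) v(2) cmp_assoc[OF \<iota> D(5) v(1)] by (simp add: g_def)
    then show "\<exists>v \<in> Hom T B Y. u = v \<cdot> g" using v(1) by blast
  next
    fix Y u assume Y: "Y \<in> \<B>" and u: "u \<in> Hom T B (susp T Y)"
      and ug: "u \<cdot> g = zero_arr T (X 0) (susp T Y)"
    have YT: "Y \<in> obj T" "susp T Y \<in> obj T" using Y assms(3) susp_obj by auto
    have uq: "u \<cdot> q \<in> Hom T P (susp T Y)" using cmp_Hom[OF D(5) u] .
    \<comment> \<open>Since \<open>q \<cdot> s = q\<close>, composing component i+1 of
      \<open>u \<cdot> q\<close> with \<open>f i\<close> gives component i; the vanishing condition
      on \<open>f i\<close> then passes zero from i to i+1.\<close>
    have uq\<iota>: "(u \<cdot> q) \<cdot> \<iota> i = zero_arr T (X i) (susp T Y)" for i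
    proof (induction i)
      case 0
      show ?case using ug cmp_assoc[OF \<iota> D(5) u] by (simp add: g_def)
    next
      case (Suc i)
      have "((u \<cdot> q) \<cdot> \<iota> (Suc i)) \<cdot> f i = (u \<cdot> q) \<cdot> (s \<cdot> \<iota> i)"
        using cmp_assoc[OF f \<iota> uq] s\<iota> by simp
      also have "\<dots> = (u \<cdot> (q \<cdot> s)) \<cdot> \<iota> i"
        using cmp_assoc[OF \<iota> s uq] cmp_assoc[OF s D(5) u] by simp
      also have "\<dots> = zero_arr T (X i) (susp T Y)" using qs Suc by simp
      finally show ?case using coconicD(3)[OF step Y cmp_Hom[OF \<iota> uq]] by blast
    qed
    have "u \<cdot> q = zero_arr T P (susp T Y)"
      by (rule coproduct_map_ext[OF P uq zero_Hom[OF PT YT(2)]])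
        (simp add: uq\<iota> cmp_zero_left[OF \<iota> YT(2)])
    then obtain v where v: "v \<in> Hom T (susp T P) (susp T Y)" "u = v \<cdot> w"
      using dist_weak_cokernel[OF dist_rotateI[OF tri] u] by blast
    obtain k where k: "k \<in> Hom T P Y" "susp_arr T k = v"
      using susp_arr_surj[OF v(1) PT YT(1)] by blast
    \<comment> \<open>The prescribed component at 0 is set to zero. Factoring \<open>k\<close>
      through \<open>d\<close> makes u factor through \<open>susp_arr T d \<cdot> w\<close>, which
      is zero.\<close>
    obtain e where e: "e \<in> Hom T P Y" "e \<cdot> d = k"
      using solve[OF Y zero_Hom[OF X YT(1)] k(1)] by blast
    have "u = (susp_arr T e \<cdot> susp_arr T d) \<cdot> w"
      using v(2) k(2) e(2) susp_arr_cmp[OF d e(1)] by simp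
    also have "\<dots> = susp_arr T e \<cdot> (susp_arr T d \<cdot> w)"
      using cmp_assoc[OF D(6) susp_arr_Hom[OF d] susp_arr_Hom[OF e(1)]] .
    also have "\<dots> = zero_arr T B (susp T Y)"
      using dist_cmp_zero3[OF tri] cmp_zero_right[OF susp_arr_Hom[OF e(1)] D(3)] by simp
    finally show "u = zero_arr T B (susp T Y)" .
  qed
  moreover have "Hom T G B = {zero_arr T G B}" if G: "G \<in> \<G>" for G
  proof -
    have GT: "G \<in> obj T" using \<G>(1)[OF G] by (simp add: weakly_compact_def)
    have "x = zero_arr T G B" if x: "x \<in> Hom T G B" for x
    proof -
      \<comment> \<open>To see that \<open>w \<cdot> x\<close> vanishes, it is desuspended to a map
        \<open>y\<close> from \<open>G'\<close>, a member of \<open>\<G>\<close> again. There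
        \<open>d\<close> acts as the identity because \<open>s\<close> acts as zero, while
        \<open>d \<cdot> y\<close> vanishes by exactness.\<close>
      define G' where "G' = desusp T G"
      have G': "G' \<in> obj T" "susp T G' = G" "G' \<in> \<G>"
        using GT desusp_obj susp_desusp \<G>(2)[OF G] by (auto simp: G'_def)
      have wx: "w \<cdot> x \<in> Hom T (susp T G') (susp T P)" using cmp_Hom[OF x D(6)] G'(2) by simp
      obtain y where y: "y \<in> Hom T G' P" "susp_arr T y = w \<cdot> x"
        using susp_arr_surj[OF wx G'(1) PT] by blast
      have "susp_arr T (d \<cdot> y) = (susp_arr T d \<cdot> w) \<cdot> x"
        using susp_arr_cmp[OF y(1) d] y(2) cmp_assoc[OF x D(6) susp_arr_Hom[OF d]] by simp
      also have "\<dots> = zero_arr T (susp T G') (susp T P)"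
        using dist_cmp_zero3[OF tri] cmp_zero_left[OF x susp_obj[OF PT]] G'(2) by simp
      finally have "d \<cdot> y = zero_arr T G' P"
        using susp_arr_eq_zero[OF cmp_Hom[OF y(1) d]] by blast
      then have "y = zero_arr T G' P"
        using split'[OF y(1)] skill[OF G'(3) y(1)] add_zero_left[OF zero_Hom[OF G'(1) PT]] by simp
      then have "w \<cdot> x = zero_arr T G (susp T P)"
        using y(2) susp_arr_zero[OF G'(1) PT] G'(2) by simp
      then obtain z where z: "z \<in> Hom T G P" "x = q \<cdot> z"
        using dist_weak_kernel[OF dist_rotateI[OF tri] x] by blast
      \<comment> \<open>Inserting \<open>s\<close> is free since \<open>q \<cdot> s = q\<close>, and
        \<open>s\<close> kills \<open>z\<close>.\<close>
      have "x = q \<cdot> s \<cdot> z" using z(2) qs cmp_assoc[OF z(1) s D(5)] by simp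
      then show ?thesis using skill[OF G z(1)] cmp_zero_right[OF D(5) GT] by simp
    qed
    then show ?thesis using Hom_zero_iff[OF GT D(3)] by blast
  qed
  ultimately show ?thesis by blast
qed

lemma coconic_ex:
  assumes "has_small_coproducts TYPE('u) T" "small TYPE('u) (UNIV :: nat set)" "\<B> \<subseteq> obj T"
    and cover: "\<And>X. X \<in> obj T \<Longrightarrow> covered_by T (left_perp T \<B>) X (\<Union>G\<in>\<G>. Hom T G X)"
    and \<G>: "\<And>G. G \<in> \<G> \<Longrightarrow> weakly_compact TYPE('u) T G" "\<And>G. G \<in> \<G> \<Longrightarrow> desusp T G \<in> \<G>"
    and X\<^sub>0: "X\<^sub>0 \<in> obj T"
  shows "\<exists>B g. coconic T \<B> X\<^sub>0 B g \<and> (\<forall>G\<in>\<G>. Hom T G B = {zero_arr T G B})"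
proof -
  \<comment> \<open>With the hypothesis on \<open>X\<close> inside the existential, choice yields
    total functions \<open>N\<close> and \<open>F\<close>, so the sequence can be defined by
    iterating \<open>N\<close>.\<close>
  have "\<forall>X. \<exists>X' f. X \<in> obj T \<longrightarrow>
      coconic T \<B> X X' f \<and> (\<forall>G\<in>\<G>. \<forall>y \<in> Hom T G X. f \<cdot> y = zero_arr T G X')"
    using coconic_step[OF cover assms(3)] by blast
  then obtain N F where NF: "\<And>X. X \<in> obj T \<Longrightarrow> coconic T \<B> X (N X) (F X)"
      "\<And>X G y. \<lbrakk>X \<in> obj T; G \<in> \<G>; y \<in> Hom T G X\<rbrakk> \<Longrightarrow> F X \<cdot> y = zero_arr T G (N X)"
    by metis
  define X where "X i = (N ^^ i) X\<^sub>0" for i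
  have X: "X i \<in> obj T" for i
  proof (induction i)
    case 0
    show ?case using X\<^sub>0 by (simp add: X_def)
  next
    case (Suc i)
    show ?case using Hom_obj(2)[OF coconicD(1)[OF NF(1)[OF Suc]]] by (simp add: X_def)
  qed
  have XS: "X (Suc i) = N (X i)" for i by (simp add: X_def)
  have "\<exists>B g. coconic T \<B> (X 0) B g \<and> (\<forall>G\<in>\<G>. Hom T G B = {zero_arr T G B})"
    by (rule coconic_hocolim[OF assms(1-3), of X "\<lambda>i. F (X i)"])
      (simp_all add: XS NF X \<G>)
  then show ?thesis by (simp add: X_def)
qed

section \<open>The generated co-t-structure\<close>

lemma desusp_Hom_zero_iff:
  assumes "X \<in> obj T" "Y \<in> obj T"
  shows "Hom T (desusp T X) Y = {zero_arr T (desusp T X) Y}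
    \<longleftrightarrow> Hom T X (susp T Y) = {zero_arr T X (susp T Y)}"
  using susp_Hom_zero_iff[OF desusp_obj[OF assms(1)] assms(2)] susp_desusp[OF assms(1)] by simp

lemma funpow_desusp_obj: "X \<in> obj T \<Longrightarrow> (desusp T ^^ n) X \<in> obj T"
  by (induction n) (simp_all add: desusp_obj)

text \<open>Connects the description of \<B> by suspensions of X with the one by desuspensions of
  members of \<open>\<S>\<close>. Each step trades one desuspension on the left for a suspension on
  the right, whence the induction over arbitrary \<open>Y\<close>.\<close>

lemma funpow_desusp_Hom_zero_iff:
  assumes "X \<in> obj T" "Y \<in> obj T"
  shows "Hom T ((desusp T ^^ n) X) Y = {zero_arr T ((desusp T ^^ n) X) Y}
    \<longleftrightarrow> Hom T X ((susp T ^^ n) Y) = {zero_arr T X ((susp T ^^ n) Y)}"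
  using assms(2)
proof (induction n arbitrary: Y)
  case 0
  show ?case by simp
next
  case (Suc n)
  have "(susp T ^^ Suc n) Y = (susp T ^^ n) (susp T Y)" by (simp add: funpow_swap1)
  then show ?case
    using desusp_Hom_zero_iff[OF funpow_desusp_obj[OF assms(1)] Suc.prems, of n]
      Suc.IH[OF susp_obj[OF Suc.prems]] by simp
qed

text \<open>Transfers smallness of Hom-sets from members of \<open>\<S>\<close> to their
  desuspensions: the suspension embeds one Hom-set into the next.\<close>

lemma funpow_desusp_Hom_lepoll:
  assumes "X \<in> obj T" "Y \<in> obj T"
  shows "\<exists>Y' \<in> obj T. Hom T ((desusp T ^^ n) X) Y \<lesssim> Hom T X Y'"
  using assms(2)
proof (induction n arbitrary: Y)
  case 0
  then show ?case using lepoll_refl by auto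
next
  case (Suc n)
  let ?D = "(desusp T ^^ n) X"
  have D: "?D \<in> obj T" using funpow_desusp_obj[OF assms(1)] .
  have "susp_arr T ` Hom T (desusp T ?D) Y \<subseteq> Hom T ?D (susp T Y)"
    using susp_arr_Hom[of _ "desusp T ?D" Y] susp_desusp[OF D] by auto
  moreover have "inj_on (susp_arr T) (Hom T (desusp T ?D) Y)"
    using susp_arr_inj by (auto intro: inj_onI)
  ultimately have "Hom T (desusp T ?D) Y \<lesssim> Hom T ?D (susp T Y)" by (auto simp: lepoll_def)
  moreover obtain Y' where "Y' \<in> obj T" "Hom T ?D (susp T Y) \<lesssim> Hom T X Y'"
    using Suc.IH[OF susp_obj[OF Suc.prems]] by blast
  ultimately show ?case using lepoll_trans by auto
qed

lemma left_perp_retract: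
  assumes "i \<in> Hom T Y X" "p \<in> Hom T X Y" "p \<cdot> i = ide T Y" "X \<in> left_perp T \<B>" "\<B> \<subseteq> obj T"
  shows "Y \<in> left_perp T \<B>"
proof -
  have Y: "Y \<in> obj T" using Hom_obj(1)[OF assms(1)] .
  have "f = zero_arr T Y B" if B: "B \<in> \<B>" and f: "f \<in> Hom T Y B" for f B
  proof -
    have "f \<cdot> p = zero_arr T X B"
      using cmp_Hom[OF assms(2) f] assms(4) B unfolding left_perp_def by blast
    moreover have "f = (f \<cdot> p) \<cdot> i"
      using cmp_assoc[OF assms(1,2) f] assms(3) cmp_ide_right[OF f] by simp
    ultimately show ?thesis using cmp_zero_left[OF assms(1)] Hom_obj(2)[OF f] by simp
  qed
  then show ?thesis using Y assms(5) Hom_zero_iff[OF Y] unfolding left_perp_def by blast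
qed

lemma desusp_retract:
  assumes "i \<in> Hom T Y X" "p \<in> Hom T X Y" "p \<cdot> i = ide T Y"
  obtains i' p' where "i' \<in> Hom T (desusp T Y) (desusp T X)" "p' \<in> Hom T (desusp T X) (desusp T Y)"
    "p' \<cdot> i' = ide T (desusp T Y)"
proof -
  have obs: "X \<in> obj T" "Y \<in> obj T" using Hom_obj[OF assms(1)] by auto
  note D = desusp_obj[OF obs(1)] desusp_obj[OF obs(2)]
  note S = susp_desusp[OF obs(1)] susp_desusp[OF obs(2)]
  obtain i' where i': "i' \<in> Hom T (desusp T Y) (desusp T X)" "susp_arr T i' = i"
    using susp_arr_surj[of i "desusp T Y" "desusp T X"] assms(1) D S by auto
  obtain p' where p': "p' \<in> Hom T (desusp T X) (desusp T Y)" "susp_arr T p' = p"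
    using susp_arr_surj[of p "desusp T X" "desusp T Y"] assms(2) D S by auto
  have "susp_arr T (p' \<cdot> i') = susp_arr T (ide T (desusp T Y))"
    using susp_arr_cmp[OF i'(1) p'(1)] i'(2) p'(2) assms(3) susp_arr_ide[OF D(2)] S(2) by simp
  then have "p' \<cdot> i' = ide T (desusp T Y)"
    by (rule susp_arr_inj[OF cmp_Hom[OF i'(1) p'(1)] ide_Hom[OF D(2)]])
  then show thesis using that i'(1) p'(1) by blast
qed

lemma left_perp_desusp:
  assumes "X \<in> left_perp T \<B>" "susp T ` \<B> \<subseteq> \<B>" "\<B> \<subseteq> obj T"
  shows "desusp T X \<in> left_perp T \<B>"
proof -
  have X: "X \<in> obj T" using assms(1) by (simp add: left_perp_def)
  have "Hom T (desusp T X) B = {zero_arr T (desusp T X) B}" if "B \<in> \<B>" for B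
  proof -
    have "susp T B \<in> \<B>" "B \<in> obj T" using that assms(2,3) by auto
    then show ?thesis using desusp_Hom_zero_iff[OF X] assms(1) by (simp add: left_perp_def)
  qed
  then show ?thesis using desusp_obj[OF X] by (simp add: left_perp_def)
qed

text \<open>Axioms (0), (1) and closure under coproducts are checked on \<B> through maps from
  \<open>\<G>\<close>. Axiom (2) is the orthogonality built into \<A>, and axiom (3) is the cocone
  of the approximation X -> B. All size considerations about \<open>\<G>\<close> are packed into
  \<open>cover\<close>.\<close>

proposition finite_type_co_t_structure_generated:
  assumes "has_small_coproducts TYPE('u) T" "small TYPE('u) (UNIV :: nat set)"
    and \<G>: "\<And>G. G \<in> \<G> \<Longrightarrow> weakly_compact TYPE('u) T G" "\<And>G. G \<in> \<G> \<Longrightarrow> desusp T G \<in> \<G>"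
    and \<B>: "\<B> = {X \<in> obj T. \<forall>G\<in>\<G>. Hom T G X = {zero_arr T G X}}"
    and cover: "\<And>X. X \<in> obj T \<Longrightarrow> covered_by T (left_perp T \<B>) X (\<Union>G\<in>\<G>. Hom T G X)"
  shows "finite_type_co_t_structure TYPE('u) T (susp_subcat T (left_perp T \<B>)) \<B>"
proof -
  let ?A = "susp_subcat T (left_perp T \<B>)"
  have \<B>T: "\<B> \<subseteq> obj T" using \<B> by simp
  have \<G>T: "G \<in> obj T" if "G \<in> \<G>" for G using \<G>(1)[OF that] by (simp add: weakly_compact_def)
  have \<B>I: "X \<in> \<B>" if "X \<in> obj T" "\<And>G x. \<lbrakk>G \<in> \<G>; x \<in> Hom T G X\<rbrakk> \<Longrightarrow> x = zero_arr T G X" for X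
    using that Hom_zero_iff[OF \<G>T] \<B> by simp
  have \<B>D: "x = zero_arr T G X" if "X \<in> \<B>" "G \<in> \<G>" "x \<in> Hom T G X" for X G x
    using that \<B> by simp
  \<comment> \<open>Closure of \<open>\<G>\<close> under desuspension transposes to closure of \<B>
    under suspension.\<close>
  have sB: "susp T ` \<B> \<subseteq> \<B>"
  proof (rule image_subsetI)
    fix X assume "X \<in> \<B>"
    then have X: "X \<in> obj T" "\<And>G. G \<in> \<G> \<Longrightarrow> Hom T G X = {zero_arr T G X}" using \<B> by simp_all
    have "Hom T G (susp T X) = {zero_arr T G (susp T X)}" if "G \<in> \<G>" for G
      using desusp_Hom_zero_iff[OF \<G>T[OF that] X(1)] X(2)[OF \<G>(2)[OF that]] by simp
    then show "susp T X \<in> \<B>" using \<B> susp_obj[OF X(1)] by simp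
  qed
  have summA: "closed_summands T ?A"
    unfolding closed_summands_def
  proof (intro allI impI)
    fix X Y Y' \<iota>
    assume X: "X \<in> ?A" and Y: "Y \<in> obj T" "Y' \<in> obj T"
      and c: "is_coproduct T (UNIV :: bool set) (\<lambda>b. if b then Y else Y') X \<iota>"
    obtain i p where ip: "i \<in> Hom T Y X" "p \<in> Hom T X Y" "p \<cdot> i = ide T Y"
      using summand_retract[OF c Y] .
    obtain i' p' where ip': "i' \<in> Hom T (desusp T Y) (desusp T X)"
        "p' \<in> Hom T (desusp T X) (desusp T Y)" "p' \<cdot> i' = ide T (desusp T Y)"
      using desusp_retract[OF ip] .
    have "desusp T X \<in> left_perp T \<B>" using X by (simp add: susp_subcat_def)
    then have "desusp T Y \<in> left_perp T \<B>" by (rule left_perp_retract[OF ip' _ \<B>T])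
    then show "Y \<in> ?A" using Y(1) by (simp add: susp_subcat_def)
  qed
  have summB: "closed_summands T \<B>"
    unfolding closed_summands_def
  proof (intro allI impI)
    fix X Y Y' \<iota>
    assume X: "X \<in> \<B>" and Y: "Y \<in> obj T" "Y' \<in> obj T"
      and c: "is_coproduct T (UNIV :: bool set) (\<lambda>b. if b then Y else Y') X \<iota>"
    obtain i p where ip: "i \<in> Hom T Y X" "p \<in> Hom T X Y" "p \<cdot> i = ide T Y"
      using summand_retract[OF c Y] .
    show "Y \<in> \<B>"
    proof (rule \<B>I[OF Y(1)])
      fix G x assume G: "G \<in> \<G>" and x: "x \<in> Hom T G Y"
      have "x = p \<cdot> i \<cdot> x"
        using cmp_assoc[OF x ip(1,2)] ip(3) cmp_ide_left[OF x] by simp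
      then show "x = zero_arr T G Y"
        using \<B>D[OF X G cmp_Hom[OF x ip(1)]] cmp_zero_right[OF ip(2) \<G>T[OF G]] by simp
    qed
  qed
  have dA: "desusp T ` ?A \<subseteq> ?A"
    using left_perp_desusp[OF _ sB \<B>T] desusp_obj by (auto simp: susp_subcat_def)
  have perp: "Hom T (desusp T A) B = {zero_arr T (desusp T A) B}" if "A \<in> ?A" "B \<in> \<B>" for A B
    using that by (simp add: susp_subcat_def left_perp_def)
  have tri: "\<exists>A\<in>?A. \<exists>B\<in>\<B>. \<exists>f g h. h \<in> Hom T B A \<and> dist_triangle T (desusp T A) X B f g h"
    if X: "X \<in> obj T" for X
  proof -
    obtain B g where B: "coconic T \<B> X B g" "\<forall>G\<in>\<G>. Hom T G B = {zero_arr T G B}"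
      using coconic_ex[OF assms(1,2) \<B>T cover \<G> X] by blast
    obtain C f h where C: "C \<in> left_perp T \<B>" "dist_triangle T C X B f g h"
      using coconic_cocone[OF B(1) \<B>T] by blast
    note D = dist_triangleD[OF C(2)]
    have "susp T C \<in> ?A"
      using C(1) D(1) by (simp add: susp_subcat_def desusp_susp susp_obj)
    moreover have "B \<in> \<B>" using B(2) D(3) \<B> by simp
    moreover have "dist_triangle T (desusp T (susp T C)) X B f g h"
      using C(2) desusp_susp[OF D(1)] by simp
    ultimately show ?thesis using D(6) by blast
  qed
  have coprod: "closed_small_coproducts TYPE('u) T \<B>"
    unfolding closed_small_coproducts_def
  proof (intro allI impI)
    fix I :: "'u set" and X P \<iota>
    assume I: "small TYPE('u) I" and X: "\<forall>i\<in>I. X i \<in> \<B>" and P: "is_coproduct T I X P \<iota>"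
    have PT: "P \<in> obj T" using P by (simp add: is_coproduct_def)
    show "P \<in> \<B>"
    proof (rule \<B>I[OF PT])
      fix G x assume G: "G \<in> \<G>" and x: "x \<in> Hom T G P"
      have "ide T P \<cdot> x = zero_arr T G P"
      \<comment> \<open>Weak compactness is applied to the identity of \<open>P\<close>: maps into
        the summands are zero, hence so are maps into \<open>P\<close>.\<close>
      proof (rule weakly_compactD[OF \<G>(1)[OF G] I P ide_Hom[OF PT] _ x])
        fix i y assume i: "i \<in> I" and y: "y \<in> Hom T G (X i)"
        have "y = zero_arr T G (X i)" using \<B>D[OF _ G y] X i by blast
        then show "ide T P \<cdot> \<iota> i \<cdot> y = zero_arr T G P"
          using cmp_zero_right[OF coproduct_inj[OF P i] \<G>T[OF G]]
            cmp_zero_right[OF ide_Hom[OF PT] \<G>T[OF G]] by simp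
      qed
      then show "x = zero_arr T G P" using cmp_ide_left[OF x] by simp
    qed
  qed
  have "?A \<subseteq> obj T" by (auto simp: susp_subcat_def)
  then show ?thesis
    unfolding finite_type_co_t_structure_def co_t_structure_def
    using \<B>T summA summB dA sB perp tri coprod by simp
qed

end

section \<open>The theorem for a set of compact objects\<close>

theorem theorem5:
  fixes T :: "('o, 'm) pretri_cat"
    and \<S> \<A> \<B> :: "'o set"
  assumes "triangulated_cat T"
    and "uncountable (UNIV :: 'u set)"
    and "has_small_coproducts TYPE('u) T"
    and "small TYPE('u) \<S>"
    and "\<And>S. S \<in> \<S> \<Longrightarrow> compact_object TYPE('u) T S"
    and "\<And>S X. \<lbrakk>S \<in> \<S>; X \<in> obj T\<rbrakk> \<Longrightarrow> small TYPE('u) (Hom T S X)"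
    and "\<B> = {X \<in> obj T. \<forall>S\<in>\<S>. \<forall>n>0. Hom T S ((susp T ^^ n) X) = {zero_arr T S ((susp T ^^ n) X)}}"
    and "\<A> = susp_subcat T (left_perp T \<B>)"
  shows "finite_type_co_t_structure TYPE('u) T \<A> \<B>"
proof -
  interpret triangulated_cat T by fact
  \<comment> \<open>Exponents start at 1, matching n > 0 in the definition of \<B>; increasing the
    exponent keeps it positive, so \<open>\<G>\<close> is closed under desuspension.\<close>
  define \<G> where "\<G> = (\<Union>S\<in>\<S>. \<Union>n\<in>{0<..}. {(desusp T ^^ n) S})"
  have S: "S \<in> obj T" if "S \<in> \<S>" for S
    using assms(5)[OF that] by (simp add: compact_object_def)
  have wc: "weakly_compact TYPE('u) T ((desusp T ^^ n) S)" if "S \<in> \<S>" for S n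
    using compact_imp_weakly_compact[OF assms(5)[OF that]]
    by (induction n) (simp_all add: weakly_compact_desusp)
  have \<B>: "\<B> = {X \<in> obj T. \<forall>G\<in>\<G>. Hom T G X = {zero_arr T G X}}"
  proof -
    have "(\<forall>S\<in>\<S>. \<forall>n>0. Hom T S ((susp T ^^ n) X) = {zero_arr T S ((susp T ^^ n) X)})
        \<longleftrightarrow> (\<forall>G\<in>\<G>. Hom T G X = {zero_arr T G X})" if "X \<in> obj T" for X
      using funpow_desusp_Hom_zero_iff[OF S that] unfolding \<G>_def by (simp add: greaterThan_def)
    then show ?thesis unfolding assms(7) by blast
  qed
  have \<B>T: "\<B> \<subseteq> obj T" using \<B> by simp
  have "finite_type_co_t_structure TYPE('u) T (susp_subcat T (left_perp T \<B>)) \<B>"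
  proof (rule finite_type_co_t_structure_generated[OF assms(3) nat_small[OF assms(2)] _ _ \<B>])
    show "weakly_compact TYPE('u) T G" if "G \<in> \<G>" for G
      using that wc by (auto simp: \<G>_def)
    show "desusp T G \<in> \<G>" if G: "G \<in> \<G>" for G
    proof -
      obtain S n where "S \<in> \<S>" "G = (desusp T ^^ n) S" using G by (auto simp: \<G>_def)
      then show ?thesis unfolding \<G>_def by (intro UN_I[of S] UN_I[of "Suc n"]) auto
    qed
    fix X assume X: "X \<in> obj T"
    \<comment> \<open>One coproduct at a time: the cardinality of \<open>'u\<close> may be singular, so that a small union of
      small sets need not be small.\<close>
    have "covered_by T (left_perp T \<B>) X (\<Union>S\<in>\<S>. \<Union>n\<in>{0<..}. \<Union>f \<in> Hom T ((desusp T ^^ n) S) X. {f})"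
    proof (intro covered_by_UN[OF assms(3) _ X \<B>T])
      show "small TYPE('u) \<S>" "small TYPE('u) {0::nat<..}" using assms(4) nat_small[OF assms(2)] .
      fix S n assume Sn: "S \<in> \<S>" "n \<in> {0::nat<..}"
      show "small TYPE('u) (Hom T ((desusp T ^^ n) S) X)"
        using funpow_desusp_Hom_lepoll[OF S[OF Sn(1)] X, of n] small_lepoll assms(6)[OF Sn(1)] by blast
      \<comment> \<open>Since \<B> is the right orthogonal of \<open>\<G>\<close>, the members of
        \<open>\<G>\<close> lie in its left orthogonal and can themselves serve as covering
        objects.\<close>
      have "(desusp T ^^ n) S \<in> \<G>" using Sn by (auto simp: \<G>_def)
      then have "(desusp T ^^ n) S \<in> left_perp T \<B>"
        using \<B> funpow_desusp_obj[OF S[OF Sn(1)]] by (simp add: left_perp_def)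
      then show "covered_by T (left_perp T \<B>) X {f}" if "f \<in> Hom T ((desusp T ^^ n) S) X" for f
        by (rule covered_by_single[OF that])
    qed
    moreover have "(\<Union>S\<in>\<S>. \<Union>n\<in>{0<..}. \<Union>f \<in> Hom T ((desusp T ^^ n) S) X. {f})
        = (\<Union>G\<in>\<G>. Hom T G X)"
      by (auto simp: \<G>_def)
    ultimately show "covered_by T (left_perp T \<B>) X (\<Union>G\<in>\<G>. Hom T G X)" by simp
  qed
  then show ?thesis using assms(8) by simp
qed

end
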